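(* Let $(\mathcal B;B_1,B_2)$ be a boundary triplet for the operator $A_0^*$ on a Hilbert space $X$, let $\mathcal K$ be a Hilbert space, and let $W_B=\begin{bmatrix}W_1&W_2\end{bmatrix}$ be a bounded everywhere-defined linear operator from $\mathcal B^2$ into $\mathcal K$. Let $A:=A_0^*\big|_{\mathrm{dom}(A)}$ be the restriction of $A_0^*$ to $$\mathrm{dom}(A)=\ker\left(\begin{bmatrix}W_1&W_2\end{bmatrix}\begin{bmatrix}B_1 \\ B_2\end{bmatrix}\right)=\{x\in\mathrm{dom}(A_0^* )\mid W_1B_1x+W_2B_2x=0\}.$$ Then the following claims are true: 1. The operator $A$ is closed. 2. The operator $A$ is dissipative (respectively, maximal dissipative) if and only if $\ker(W_B)$ is a dissipative (respectively, maximal dissipative) relation in $\mathcal B$. 3. The adjoint of $A$ is $A^*=-A_0^*\big|_{\mathrm{dom}(A^* )}$, where $$\mathrm{dom}(A^* )=\left\{x\in\mathrm{dom}(A_0^* )\;\middle|\;\begin{bmatrix}B_1x \\ B_2x\end{bmatrix}\in\overline{\mathrm{ran}\begin{bmatrix}W_2^* \\ W_1^*\end{bmatrix}}\right\}.$$ 4. The adjoint $A^*$ is dissipative if and only if $W_1W_2^*+W_2W_1^*\ge0$ in $\mathcal K$. The adjoint is skew-symmetric, i.e. $\mathrm{Re}\langle A^*x,x\rangle=0$ for all $x\in\mathrm{dom}(A^* )$, if and only if $W_1W_2^*+W_2W_1^*=0$. 5. The operator $A$ generates a contraction semigroup on $X$ if and only if $A$ is dissipative and $W_1W_2^*+W_2W_1^*\ge0$.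 6. The operator $A$ generates a unitary group on $X$ if and only if $A$ is skew-symmetric and $W_1W_2^*+W_2W_1^*=0$.
   Context: Hilbert spaces are complex. Semigroups and groups are strongly continuous. Elements of $\mathcal B^2$ are written as columns, and $\begin{bmatrix}W_1&W_2\end{bmatrix}\begin{bmatrix}f \\ e\end{bmatrix}=W_1f+W_2e$. Boundary triplet: let $A_0$ be a densely defined, skew-symmetric, closed linear operator on a Hilbert space $X$. A boundary triplet for $A_0^*$ is a triple $(\mathcal B;B_1,B_2)$ consisting of a Hilbert space $\mathcal B$ and two bounded linear operators $B_1,B_2:\mathrm{dom}(A_0^* )\to\mathcal B$ (where $\mathrm{dom}(A_0^* )$ carries the graph norm) such that $\begin{bmatrix}B_1 \\ B_2\end{bmatrix}\mathrm{dom}(A_0^* )=\mathcal B^2$ and, for all $x,\tilde x\in\mathrm{dom}(A_0^* )$, $$\langle A_0^*x,\tilde x\rangle_X+\langle x,A_0^*\tilde x\rangle_X=\langle B_1x,B_2\tilde x\rangle_{\mathcal B}+\langle B_2x,B_1\tilde x\rangle_{\mathcal B}.$$ Relations: a (linear) relation in a Hilbert space $H$ is a linear subspace $R\subset H^2$. It is dissipative if $\mathrm{Re}\langle r_1,r_2\rangle\le0$ for all $\begin{bmatrix}r_1 \\ r_2\end{bmatrix}\in R$; maximal dissipative if it is dissipative and has no proper extension to a dissipative relation in $H$; skew-symmetric if $\mathrm{Re}\langle r_1,r_2\rangle=0$ for all $\begin{bmatrix}r_1 \\ r_2\end{bmatrix}\in R$. An operator on $H$ is called (maximal) dissipative or skew-symmetric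 if its graph $\left\{\begin{bmatrix}x \\ Ax\end{bmatrix}\mid x\in\mathrm{dom}(A)\right\}$ has the corresponding property. *)

theory Defs
  imports "HOL-Analysis.Analysis"
begin

section \<open>Complex Hilbert spaces\<close>

text \<open>A complex inner product space is a real one (whose norm, metric and topology are thereby
  available) with a complex scalar multiplication extending the real one and a complex inner product,
  linear in the first argument, whose real part is the real inner product. In particular
  \<open>norm x = sqrt (Re (cinner x x))\<close>.\<close>

class complex_inner = real_inner +
  fixes scaleC :: "complex \<Rightarrow> 'a \<Rightarrow> 'a"  (infixr \<open>*\<^sub>C\<close> 75)
    and cinner :: "'a \<Rightarrow> 'a \<Rightarrow> complex"
  assumes scaleC_add_right: "c *\<^sub>C (x + y) = c *\<^sub>C x + c *\<^sub>C y"
    and scaleC_add_left: "(c + d) *\<^sub>C x = c *\<^sub>C x + d *\<^sub>C x"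
    and scaleC_scaleC: "c *\<^sub>C d *\<^sub>C x = (c * d) *\<^sub>C x"
    and scaleR_scaleC: "r *\<^sub>R x = complex_of_real r *\<^sub>C x"
    and cinner_commute: "cinner x y = cnj (cinner y x)"
    and cinner_add_left: "cinner (x + y) z = cinner x z + cinner y z"
    and cinner_scaleC_left: "cinner (c *\<^sub>C x) y = c * cinner x y"
    and inner_eq_Re_cinner: "inner x y = Re (cinner x y)"

class chilbert_space = complex_inner + complete_space

instantiation complex :: chilbert_space
begin

definition "c *\<^sub>C (z::complex) = c * z"
definition "cinner (z::complex) w = z * cnj w"

instance
  by standard (auto simp: scaleC_complex_def cinner_complex_def algebra_simps scaleR_conv_of_real
      inner_complex_def)

end

instantiation prod :: (complex_inner, complex_inner) complex_inner
begin

definition "c *\<^sub>C p = (c *\<^sub>C fst p, c *\<^sub>C snd p)"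
definition "cinner p q = cinner (fst p) (fst q) + cinner (snd p) (snd q)"

instance
proof
  fix c d :: complex and r :: real and p q s :: "'a \<times> 'b"
  show "cinner p q = cnj (cinner q p)"
    by (simp add: cinner_prod_def cinner_commute[of "fst p"] cinner_commute[of "snd p"])
qed (auto simp: scaleC_prod_def cinner_prod_def scaleC_add_right scaleC_add_left scaleC_scaleC
    scaleR_scaleC scaleR_prod_def cinner_add_left cinner_scaleC_left inner_eq_Re_cinner
    inner_prod_def algebra_simps)

end

instance prod :: (chilbert_space, chilbert_space) chilbert_space ..

definition csubspace :: "'a::complex_inner set \<Rightarrow> bool" where
  "csubspace S \<longleftrightarrow> subspace S \<and> (\<forall>c. \<forall>x\<in>S. c *\<^sub>C x \<in> S)"

definition bounded_clinear :: "('a::complex_inner \<Rightarrow> 'b::complex_inner) \<Rightarrow> bool" where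
  "bounded_clinear T \<longleftrightarrow> bounded_linear T \<and> (\<forall>c x. T (c *\<^sub>C x) = c *\<^sub>C T x)"

text \<open>The Hilbert space adjoint of a bounded operator; it exists and is unique if \<open>T\<close> satisfies
  \<open>bounded_clinear\<close>.\<close>

definition cadjoint :: "('a::chilbert_space \<Rightarrow> 'b::chilbert_space) \<Rightarrow> 'b \<Rightarrow> 'a" where
  "cadjoint T = (THE S. \<forall>x y. cinner (T x) y = cinner x (S y))"

definition nonneg_operator :: "('a::chilbert_space \<Rightarrow> 'a) \<Rightarrow> bool" where
  "nonneg_operator T \<longleftrightarrow> (\<forall>x. cinner (T x) x \<in> \<real> \<and> 0 \<le> Re (cinner (T x) x))"

definition unitary :: "('a::chilbert_space \<Rightarrow> 'a) \<Rightarrow> bool" where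
  "unitary U \<longleftrightarrow> bounded_clinear U \<and> surj U \<and> (\<forall>x y. cinner (U x) (U y) = cinner x y)"


section \<open>Linear relations and unbounded operators\<close>

definition linear_relation :: "('a::complex_inner \<times> 'a) set \<Rightarrow> bool" where
  "linear_relation R \<longleftrightarrow> csubspace R"

definition dissipative :: "('a::complex_inner \<times> 'a) set \<Rightarrow> bool" where
  "dissipative R \<longleftrightarrow> linear_relation R \<and> (\<forall>(r1, r2)\<in>R. Re (cinner r1 r2) \<le> 0)"

definition maximal_dissipative :: "('a::complex_inner \<times> 'a) set \<Rightarrow> bool" where
  "maximal_dissipative R \<longleftrightarrow> dissipative R \<and> (\<forall>S. dissipative S \<and> R \<subseteq> S \<longrightarrow> S = R)"

definition skew_symmetric :: "('a::complex_inner \<times> 'a) set \<Rightarrow> bool" where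
  "skew_symmetric R \<longleftrightarrow> linear_relation R \<and> (\<forall>(r1, r2)\<in>R. Re (cinner r1 r2) = 0)"

text \<open>An unbounded operator is identified with its graph: its domain is \<^const>\<open>Domain\<close>, and it is
  a closed operator iff the graph satisfies \<^const>\<open>closed\<close> in the product topology.\<close>

definition linear_operator :: "('a::complex_inner \<times> 'a) set \<Rightarrow> bool" where
  "linear_operator A \<longleftrightarrow> linear_relation A \<and> single_valued A"

definition densely_defined :: "('a::complex_inner \<times> 'a) set \<Rightarrow> bool" where
  "densely_defined A \<longleftrightarrow> closure (Domain A) = UNIV"

text \<open>\<open>y\<close> is in the domain of the adjoint and is mapped to \<open>z\<close> iff \<open>\<langle>Ax, y\<rangle> = \<langle>x, z\<rangle>\<close> for all \<open>x\<close> in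
  the domain of \<open>A\<close>. This is single-valued exactly if \<open>A\<close> is densely defined.\<close>

definition op_adjoint :: "('a::complex_inner \<times> 'a) set \<Rightarrow> ('a \<times> 'a) set" where
  "op_adjoint A = {(y, z). \<forall>(x, w)\<in>A. cinner w y = cinner x z}"

definition op_restrict :: "('a \<times> 'b) set \<Rightarrow> 'a set \<Rightarrow> ('a \<times> 'b) set" where
  "op_restrict A D = {(x, y). (x, y) \<in> A \<and> x \<in> D}"

definition op_uminus :: "('a \<times> 'b::uminus) set \<Rightarrow> ('a \<times> 'b) set" where
  "op_uminus A = {(x, - y) | x y. (x, y) \<in> A}"


section \<open>Boundary triplets\<close>

text \<open>A map defined on the domain of an operator \<open>A\<close> is represented by a total function of which only
  the values on \<^term>\<open>Domain A\<close> matter. For \<open>(x, y)\<close> in the graph of \<open>A\<close>, \<open>norm (x, y)\<close> is the graph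
  norm of \<open>x\<close>.\<close>

definition graph_bounded_clinear ::
    "('a::complex_inner \<times> 'a) set \<Rightarrow> ('a \<Rightarrow> 'b::complex_inner) \<Rightarrow> bool" where
  "graph_bounded_clinear A B \<longleftrightarrow>
     (\<forall>x\<in>Domain A. \<forall>y\<in>Domain A. B (x + y) = B x + B y) \<and>
     (\<forall>c. \<forall>x\<in>Domain A. B (c *\<^sub>C x) = c *\<^sub>C B x) \<and>
     (\<exists>C. \<forall>(x, y)\<in>A. norm (B x) \<le> C * norm (x, y))"

definition boundary_triplet ::
    "('x::chilbert_space \<times> 'x) set \<Rightarrow> ('x \<Rightarrow> 'b::chilbert_space) \<Rightarrow> ('x \<Rightarrow> 'b) \<Rightarrow> bool" where
  "boundary_triplet A0 B1 B2 \<longleftrightarrow>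
     graph_bounded_clinear (op_adjoint A0) B1 \<and>
     graph_bounded_clinear (op_adjoint A0) B2 \<and>
     (\<lambda>x. (B1 x, B2 x)) ` Domain (op_adjoint A0) = UNIV \<and>
     (\<forall>(x, y)\<in>op_adjoint A0. \<forall>(x', y')\<in>op_adjoint A0.
        cinner y x' + cinner x y' = cinner (B1 x) (B2 x') + cinner (B2 x) (B1 x'))"


section \<open>Strongly continuous semigroups and groups\<close>

text \<open>Only the values of \<open>T\<close> at nonnegative times matter for a semigroup.\<close>

definition C0_semigroup :: "(real \<Rightarrow> 'a::chilbert_space \<Rightarrow> 'a) \<Rightarrow> bool" where
  "C0_semigroup T \<longleftrightarrow>
     (\<forall>t\<ge>0. bounded_clinear (T t)) \<and>
     T 0 = id \<and>
     (\<forall>s\<ge>0. \<forall>t\<ge>0. T (s + t) = T s \<circ> T t) \<and>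
     (\<forall>x. ((\<lambda>t. T t x) \<longlongrightarrow> x) (at_right 0))"

definition semigroup_generator ::
    "(real \<Rightarrow> 'a::chilbert_space \<Rightarrow> 'a) \<Rightarrow> ('a \<times> 'a) set" where
  "semigroup_generator T = {(x, y). ((\<lambda>t. (T t x - x) /\<^sub>R t) \<longlongrightarrow> y) (at_right 0)}"

definition generates_contraction_semigroup :: "('a::chilbert_space \<times> 'a) set \<Rightarrow> bool" where
  "generates_contraction_semigroup A \<longleftrightarrow>
     (\<exists>T. C0_semigroup T \<and> (\<forall>t\<ge>0. \<forall>x. norm (T t x) \<le> norm x) \<and> semigroup_generator T = A)"

definition C0_group :: "(real \<Rightarrow> 'a::chilbert_space \<Rightarrow> 'a) \<Rightarrow> bool" where
  "C0_group T \<longleftrightarrow>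
     (\<forall>t. bounded_clinear (T t)) \<and>
     T 0 = id \<and>
     (\<forall>s t. T (s + t) = T s \<circ> T t) \<and>
     (\<forall>x. ((\<lambda>t. T t x) \<longlongrightarrow> x) (at 0))"

definition group_generator ::
    "(real \<Rightarrow> 'a::chilbert_space \<Rightarrow> 'a) \<Rightarrow> ('a \<times> 'a) set" where
  "group_generator T = {(x, y). ((\<lambda>t. (T t x - x) /\<^sub>R t) \<longlongrightarrow> y) (at 0)}"

definition generates_unitary_group :: "('a::chilbert_space \<times> 'a) set \<Rightarrow> bool" where
  "generates_unitary_group A \<longleftrightarrow>
     (\<exists>T. C0_group T \<and> (\<forall>t. unitary (T t)) \<and> group_generator T = A)"

end

theory Submission
  imports Defs
begin

text \<open>Everything takes place between \<open>-A\<^sub>0\<close> and \<open>A\<^sub>0\<^sup>*\<close>. By Green's identity the form \<open>Re \<langle>x, A\<^sub>0\<^sup>* x\<rangle>\<close>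
  equals \<open>Re \<langle>B\<^sub>1 x, B\<^sub>2 x\<rangle>\<close>, and the map \<open>x \<mapsto> (B\<^sub>1 x, B\<^sub>2 x)\<close> is onto \<open>\<B>\<^sup>2\<close> and vanishes on the domain of
  \<open>-A\<^sub>0\<close>. Sending a relation \<open>N\<close> in \<open>\<B>\<close> to the restriction of \<open>A\<^sub>0\<^sup>*\<close> to those \<open>x\<close> with
  \<open>(B\<^sub>1 x, B\<^sub>2 x) \<in> N\<close> therefore preserves and reflects dissipativity. It also preserves and reflects
  maximality, because a dissipative extension of the skew-symmetric operator \<open>-A\<^sub>0\<close> cannot leave
  \<open>A\<^sub>0\<^sup>*\<close> (\<open>dissipative_extension_subset_adjoint\<close>). The operator \<open>A\<close> is the case \<open>N = ker W\<^sub>B\<close>.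

  Green's identity also says that the adjoint of such a restriction is \<open>-A\<^sub>0\<^sup>*\<close> on those \<open>x\<close> for which
  \<open>(B\<^sub>2 x, B\<^sub>1 x)\<close> is orthogonal to \<open>N\<close>. For \<open>N = ker W\<^sub>B\<close> the orthogonal complement is the closure of
  the range of \<open>W\<^sub>B\<^sup>*\<close>, and the form of \<open>A\<^sup>*\<close> becomes, up to a negative factor, that of
  \<open>W\<^sub>1 W\<^sub>2\<^sup>* + W\<^sub>2 W\<^sub>1\<^sup>*\<close>, which gives the conditions on this operator.

  The statements about semigroups and groups then follow from two general theorems on a closed, densely
  defined \<open>A\<close>: it generates a contraction semigroup iff \<open>A\<close> and \<open>A\<^sup>*\<close> are dissipative
  (\<open>Lumer_Phillips\<close>), and a unitary group iff both are skew-symmetric (\<open>unitary_group_generation\<close>).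
  The projection theorem shows that \<open>I - h A\<close> is onto, so that the resolvents \<open>J\<^sub>h = (I - h A)\<^sup>-\<^sup>1\<close> are
  everywhere defined contractions, and the semigroup is the limit of the backward Euler scheme along dyadic steps,
  \<open>T(t) x = lim\<^sub>k J\<^sub>h\<^bsup>2^k\<^esup> x\<close> with \<open>h = t / 2^k\<close>. The engine is the telescoping estimate
  \<open>\<parallel>P\<^sup>n x - Q\<^sup>n x\<parallel> \<le> n \<parallel>P x - Q x\<parallel>\<close> for commuting contractions (\<open>contraction_power_diff\<close>). It yields
  convergence, since halving a step costs \<open>O(h\<^sup>2)\<close> on \<open>dom(A\<^sup>2)\<close>; and it shows that two commuting
  families which double correctly and are tangent to each other at \<open>0\<close> coincide
  (\<open>contraction_families_eq\<close>), whence the semigroup law and the fact that the semigroups generated by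
  \<open>A\<close> and \<open>-A\<close> are inverse to each other. No operator exponential or integral is involved.\<close>

instance chilbert_space \<subseteq> banach ..

section \<open>Hilbert space geometry\<close>

lemma cinner_add_right: "cinner x (y + z) = cinner x y + cinner x z"
  for x :: "'a::complex_inner"
  by (metis cinner_add_left cinner_commute complex_cnj_add)

lemma cinner_scaleC_right: "cinner x (c *\<^sub>C y) = cnj c * cinner x y"
  for x :: "'a::complex_inner"
  by (metis cinner_commute cinner_scaleC_left complex_cnj_mult)

text \<open>Together with \<open>inner_eq_Re_cinner\<close> this recovers the complex inner product from the real one, so
  that most arguments below can be carried out with \<^const>\<open>inner\<close>.\<close>

lemma Im_cinner: "Im (cinner x y) = inner x (\<i> *\<^sub>C y)"
  for x :: "'a::complex_inner"
  by (simp add: inner_eq_Re_cinner cinner_scaleC_right)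

lemma norm_scaleC: "norm (c *\<^sub>C x) = cmod c * norm x"
  for x :: "'a::complex_inner"
proof -
  have "Im (cinner x x) = 0"
    using arg_cong[OF cinner_commute[of x x], of Im] by simp
  then have "inner (c *\<^sub>C x) (c *\<^sub>C x) = (cmod c)\<^sup>2 * inner x x"
    unfolding cmod_power2
    by (simp add: inner_eq_Re_cinner cinner_scaleC_left cinner_scaleC_right
        power2_eq_square algebra_simps)
  then show ?thesis
    by (simp add: norm_eq_sqrt_inner real_sqrt_mult)
qed

lemma bounded_bilinear_cinner:
  "bounded_bilinear (cinner :: 'a::complex_inner \<Rightarrow> 'a \<Rightarrow> complex)"
proof
  show "\<exists>K. \<forall>x y :: 'a. norm (cinner x y) \<le> norm x * norm y * K"
  proof (intro exI allI)
    fix x y :: 'a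
    have "\<bar>inner x (\<i> *\<^sub>C y)\<bar> \<le> norm x * norm y"
      using Cauchy_Schwarz_ineq2[of x "\<i> *\<^sub>C y"] by (simp add: norm_scaleC)
    then show "norm (cinner x y) \<le> norm x * norm y * 2"
      using cmod_le[of "cinner x y"] Cauchy_Schwarz_ineq2[of x y]
      by (simp add: Im_cinner inner_eq_Re_cinner[symmetric])
  qed
qed (simp_all add: cinner_add_left cinner_add_right scaleR_scaleC cinner_scaleC_left
    cinner_scaleC_right scaleC_complex_def)

lemmas cinner_simps =
  bounded_bilinear.zero_left[OF bounded_bilinear_cinner]
  bounded_bilinear.zero_right[OF bounded_bilinear_cinner]
  bounded_bilinear.minus_left[OF bounded_bilinear_cinner]
  bounded_bilinear.minus_right[OF bounded_bilinear_cinner]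
  bounded_bilinear.diff_left[OF bounded_bilinear_cinner]
  bounded_bilinear.diff_right[OF bounded_bilinear_cinner]

text \<open>Real orthogonality to a set invariant under multiplication by \<open>\<i>\<close> is complex orthogonality: test
  with \<open>\<i> x\<close> to see the imaginary part.\<close>

lemma cinner_eq_0_if_inner_eq_0_on:
  fixes S :: "'a::complex_inner set"
  assumes S: "\<And>c x. x \<in> S \<Longrightarrow> c *\<^sub>C x \<in> S" and "x \<in> S"
    and "\<And>x. x \<in> S \<Longrightarrow> inner x y = 0"
  shows "cinner x y = 0"
proof (rule complex_eqI)
  have "\<i> *\<^sub>C x \<in> S" using assms by blast
  then have "inner (\<i> *\<^sub>C x) y = 0" using assms by blast
  then show "Im (cinner x y) = Im 0"
    by (simp add: inner_eq_Re_cinner cinner_scaleC_left)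
qed (use assms in \<open>auto simp: inner_eq_Re_cinner\<close>)

text \<open>A sequence in \<open>S\<close> whose distances to \<open>u\<close> approach the infimum is Cauchy by the parallelogram law, and
  its limit is the closest point.\<close>

lemma Hilbert_projection:
  fixes S :: "'a::{real_inner, complete_space} set"
  assumes S: "subspace S" "closed S"
  obtains p where "p \<in> S" "\<And>s. s \<in> S \<Longrightarrow> inner (u - p) s = 0"
proof -
  define d where "d = infdist u S"
  have ne: "S \<noteq> {}" using S subspace_0 by auto
  have d: "d \<le> norm (u - s)" if "s \<in> S" for s
    using infdist_le[OF that, of u] by (simp add: d_def dist_norm)
  have "\<exists>s\<in>S. norm (u - s) < d + 1 / real (Suc n)" for n
    using ne cInf_lessD[of "dist u ` S" "d + 1 / real (Suc n)"]
    by (auto simp: d_def infdist_notempty[OF ne] dist_norm)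
  then obtain s where s: "\<And>n. s n \<in> S" "\<And>n. norm (u - s n) < d + 1 / real (Suc n)"
    by metis
  have d0: "0 \<le> d" by (simp add: d_def infdist_nonneg)
  \<comment> \<open>The parallelogram law; the midpoint of two points of \<open>S\<close> is in \<open>S\<close>.\<close>
  have par: "(norm (s m - s n))\<^sup>2 \<le> 2 * (norm (u - s m))\<^sup>2 + 2 * (norm (u - s n))\<^sup>2 - 4 * d\<^sup>2" for m n
  proof -
    have "(1/2) *\<^sub>R (s m + s n) \<in> S"
      using S s by (simp add: subspace_add subspace_scale)
    then have "d\<^sup>2 \<le> (norm (u - (1/2) *\<^sub>R (s m + s n)))\<^sup>2"
      using d d0 by (simp add: power_mono)
    then show ?thesis
      by (simp add: power2_norm_eq_inner inner_diff inner_add_left inner_add_right inner_commute algebra_simps)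
  qed
  have lim: "(\<lambda>n. norm (u - s n)) \<longlonglongrightarrow> d"
  proof (rule tendsto_sandwich[of "\<lambda>_. d"])
    show "(\<lambda>n. d + 1 / real (Suc n)) \<longlonglongrightarrow> d"
      using tendsto_add[OF tendsto_const LIMSEQ_inverse_real_of_nat, of d] by (simp add: field_simps)
  qed (use s d in \<open>auto intro!: always_eventually simp: less_imp_le\<close>)
  have "Cauchy s"
  proof (rule CauchyI)
    fix e :: real assume "0 < e"
    have "(\<lambda>n. (norm (u - s n))\<^sup>2) \<longlonglongrightarrow> d\<^sup>2"
      using lim by (rule tendsto_power)
    then have "\<forall>\<^sub>F n in sequentially. (norm (u - s n))\<^sup>2 < d\<^sup>2 + e\<^sup>2 / 4"
      using \<open>0 < e\<close> by (intro order_tendstoD) auto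
    then obtain N where N: "\<And>n. n \<ge> N \<Longrightarrow> (norm (u - s n))\<^sup>2 < d\<^sup>2 + e\<^sup>2 / 4"
      by (auto simp: eventually_sequentially)
    have "norm (s m - s n) < e" if "m \<ge> N" "n \<ge> N" for m n
    proof -
      have "(norm (s m - s n))\<^sup>2 < e\<^sup>2"
        using par[of m n] N[OF that(1)] N[OF that(2)] by simp
      then show ?thesis using \<open>0 < e\<close> power_less_imp_less_base by fastforce
    qed
    then show "\<exists>M. \<forall>m\<ge>M. \<forall>n\<ge>M. norm (s m - s n) < e" by blast
  qed
  then obtain p where p: "s \<longlonglongrightarrow> p"
    using Cauchy_convergent convergent_def by blast
  have "p \<in> S" using S(2) s(1) p closed_sequentially by blast
  have "(\<lambda>n. norm (u - s n)) \<longlonglongrightarrow> norm (u - p)"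
    using p by (intro tendsto_intros)
  then have pd: "norm (u - p) = d" using lim LIMSEQ_unique by blast
  show ?thesis
  proof (rule that[OF \<open>p \<in> S\<close>])
    fix v assume "v \<in> S"
    show "inner (u - p) v = 0"
    proof (cases "v = 0")
      case False
      \<comment> \<open>Compare \<open>p\<close> with the minimiser on the line through \<open>p\<close> in direction \<open>v\<close>.\<close>
      define c where "c = inner (u - p) v / inner v v"
      have "p + c *\<^sub>R v \<in> S"
        using S \<open>p \<in> S\<close> \<open>v \<in> S\<close> by (simp add: subspace_add subspace_scale)
      then have "(norm (u - p))\<^sup>2 \<le> (norm (u - (p + c *\<^sub>R v)))\<^sup>2"
        using d d0 by (simp add: power_mono pd)
      also have "\<dots> = (norm (u - p))\<^sup>2 - 2 * c * inner (u - p) v + c * (c * inner v v)"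
        by (simp add: power2_norm_eq_inner inner_diff inner_add_left inner_add_right inner_commute algebra_simps)
      also have "c * inner v v = inner (u - p) v" using False by (simp add: c_def)
      finally have "c * inner (u - p) v \<le> 0" by simp
      moreover have "c * inner (u - p) v = (inner (u - p) v)\<^sup>2 / inner v v"
        by (simp add: c_def power2_eq_square)
      ultimately show ?thesis using False
        using inner_gt_zero_iff[of v] by (auto simp: divide_le_0_iff simp del: inner_gt_zero_iff)
    qed simp
  qed
qed

text \<open>A nonzero functional is determined, up to a factor, by the direction orthogonal to its kernel.\<close>

lemma Riesz_representation:
  fixes f :: "'a::{real_inner, complete_space} \<Rightarrow> real"
  assumes f: "bounded_linear f"
  obtains a where "\<And>x. f x = inner x a"
proof (cases "\<forall>x. f x = 0")
  case True
  then show ?thesis using that[of 0] by simp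
next
  case False
  then obtain u where u: "f u \<noteq> 0" by blast
  interpret f: bounded_linear f by fact
  have "closed (f -` {0})"
    using f.continuous_on[OF continuous_on_id] by (intro closed_vimage) auto
  moreover have "subspace (f -` {0})"
    by (simp add: subspace_def f.add f.scaleR f.zero)
  ultimately obtain p where p: "f p = 0" and orth: "\<And>s. f s = 0 \<Longrightarrow> inner (u - p) s = 0"
    using Hilbert_projection[of "f -` {0}" u] by auto
  define v where "v = u - p"
  have fv: "f v = f u" by (simp add: v_def f.diff p)
  then have v: "inner v v \<noteq> 0" using u f.zero by auto
  have "f x = inner x ((f v / inner v v) *\<^sub>R v)" for x
  proof -
    have "f (x - (f x / f v) *\<^sub>R v) = 0" using fv u by (simp add: f.diff f.scaleR)
    from orth[OF this] have "inner v x = (f x / f v) * inner v v"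
      by (simp add: v_def[symmetric] inner_diff_right)
    then show ?thesis using v fv u by (simp add: inner_commute field_simps)
  qed
  then show ?thesis by (rule that)
qed

lemma inner_cinner_eqI:
  fixes T :: "'a::complex_inner \<Rightarrow> 'b::complex_inner"
  assumes "\<And>c x. T (c *\<^sub>C x) = c *\<^sub>C T x" "\<And>x. inner (T x) y = inner x z"
  shows "cinner (T x) y = cinner x z"
proof (rule complex_eqI)
  show "Im (cinner (T x) y) = Im (cinner x z)"
    using assms(2)[of "\<i> *\<^sub>C x"]
    by (simp add: inner_eq_Re_cinner cinner_scaleC_left assms(1))
qed (use assms(2)[of x] in \<open>simp add: inner_eq_Re_cinner\<close>)

lemma cinner_eq_all_imp_eq:
  assumes "\<And>x :: 'a::complex_inner. cinner x y = cinner x z"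
  shows "y = z"
proof -
  have "inner (y - z) y = inner (y - z) z"
    by (simp only: inner_eq_Re_cinner assms)
  then have "inner (y - z) (y - z) = 0"
    by (simp add: inner_diff_right)
  then show ?thesis by simp
qed

text \<open>Riesz for the real functional \<open>x \<mapsto> Re \<langle>T x, y\<rangle>\<close>; complex homogeneity of \<open>T\<close> takes care of the
  imaginary part.\<close>

lemma cinner_cadjoint:
  fixes T :: "'a::chilbert_space \<Rightarrow> 'b::chilbert_space"
  assumes T: "bounded_clinear T"
  shows "cinner (T x) y = cinner x (cadjoint T y)"
proof -
  have lin: "bounded_linear T" and C: "\<And>c x. T (c *\<^sub>C x) = c *\<^sub>C T x"
    using T by (auto simp: bounded_clinear_def)
  have "\<exists>a. \<forall>x. cinner (T x) y = cinner x a" for y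
  proof -
    have "bounded_linear (\<lambda>x. inner (T x) y)"
      using bounded_linear_compose[OF bounded_linear_inner_left lin] .
    then obtain a where "\<And>x. inner (T x) y = inner x a"
      using Riesz_representation by blast
    then show ?thesis using inner_cinner_eqI[OF C] by blast
  qed
  then obtain S where S: "\<forall>x y. cinner (T x) y = cinner x (S y)" by metis
  have "\<forall>x y. cinner (T x) y = cinner x (cadjoint T y)"
    unfolding cadjoint_def
  proof (rule theI[of _ S])
    fix S' assume S': "\<forall>x y. cinner (T x) y = cinner x (S' y)"
    show "S' = S"
    proof
      fix y show "S' y = S y"
        by (rule cinner_eq_all_imp_eq) (use S S' in metis)
    qed
  qed (fact S)
  then show ?thesis by blast
qed

lemma cadjoint_add:
  assumes "bounded_clinear T"
  shows "cadjoint T (y + z) = cadjoint T y + cadjoint T z"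
  by (rule cinner_eq_all_imp_eq)
    (simp add: cinner_add_right flip: cinner_cadjoint[OF assms])

lemma cadjoint_scaleC:
  assumes "bounded_clinear T"
  shows "cadjoint T (c *\<^sub>C y) = c *\<^sub>C cadjoint T y"
  by (rule cinner_eq_all_imp_eq)
    (simp add: cinner_scaleC_right flip: cinner_cadjoint[OF assms])

text \<open>Polarization with the second vector \<open>M x\<close>: the cross terms of the form at \<open>x + M x\<close> are
  \<open>2 \<parallel>M x\<parallel>\<^sup>2\<close>.\<close>

lemma symmetric_form_zero:
  fixes M :: "'a::complex_inner \<Rightarrow> 'a"
  assumes add: "\<And>x y. M (x + y) = M x + M y"
    and sym: "\<And>x y. inner (M x) y = inner x (M y)"
    and zero: "\<And>x. inner (M x) x = 0"
  shows "M x = 0"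
proof -
  have "inner (M (x + M x)) (x + M x) = 2 * inner (M x) (M x)"
    using zero[of x] zero[of "M x"] sym[of "M x" x]
    by (simp add: add inner_add_left inner_add_right inner_commute)
  then show ?thesis using zero[of "x + M x"] by simp
qed

lemma subspace_closure:
  fixes S :: "'a::real_normed_vector set"
  assumes "subspace S"
  shows "subspace (closure S)"
proof (rule subspaceI)
  show "0 \<in> closure S"
    using subspace_0[OF assms] closure_subset by blast
next
  fix x y assume "x \<in> closure S" "y \<in> closure S"
  then obtain f g where f: "\<And>n. f n \<in> S" "f \<longlonglongrightarrow> x" and g: "\<And>n. g n \<in> S" "g \<longlonglongrightarrow> y"
    unfolding closure_sequential by auto
  have "(\<lambda>n. f n + g n) \<longlonglongrightarrow> x + y" by (intro tendsto_intros f g)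
  moreover have "f n + g n \<in> S" for n by (intro subspace_add[OF assms] f g)
  ultimately show "x + y \<in> closure S"
    unfolding closure_sequential by (intro exI[of _ "\<lambda>n. f n + g n"]) simp
next
  fix c x assume "x \<in> closure S"
  then obtain f where f: "\<And>n. f n \<in> S" "f \<longlonglongrightarrow> x"
    unfolding closure_sequential by auto
  have "(\<lambda>n. c *\<^sub>R f n) \<longlonglongrightarrow> c *\<^sub>R x" by (intro tendsto_intros f)
  moreover have "c *\<^sub>R f n \<in> S" for n by (intro subspace_scale[OF assms] f)
  ultimately show "c *\<^sub>R x \<in> closure S"
    unfolding closure_sequential by (intro exI[of _ "\<lambda>n. c *\<^sub>R f n"]) simp
qed

lemma inner_self_le_0: "inner x x \<le> 0 \<Longrightarrow> x = 0"
  using inner_ge_zero[of x] inner_eq_zero_iff[of x] by linarith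

lemma scaleC_zero: "c *\<^sub>C (0 :: 'a::complex_inner) = 0"
  using scaleC_add_right[of c 0 "0 :: 'a"] by simp

lemma scaleC_minus_1: "(- 1) *\<^sub>C x = - x" for x :: "'a::complex_inner"
  using scaleR_scaleC[of "- 1" x] by simp

section \<open>Linear relations and their adjoints\<close>

lemma linear_relationD:
  assumes "linear_relation A"
  shows linear_relation_add: "(x, y) \<in> A \<Longrightarrow> (x', y') \<in> A \<Longrightarrow> (x + x', y + y') \<in> A"
    and linear_relation_diff: "(x, y) \<in> A \<Longrightarrow> (x', y') \<in> A \<Longrightarrow> (x - x', y - y') \<in> A"
    and linear_relation_scaleR: "(x, y) \<in> A \<Longrightarrow> (r *\<^sub>R x, r *\<^sub>R y) \<in> A"
    and linear_relation_scaleC: "(x, y) \<in> A \<Longrightarrow> (c *\<^sub>C x, c *\<^sub>C y) \<in> A"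
    and linear_relation_0: "(0, 0) \<in> A"
proof -
  have A: "subspace A" and C: "\<And>c p. p \<in> A \<Longrightarrow> c *\<^sub>C p \<in> A"
    using assms by (auto simp: linear_relation_def csubspace_def)
  show "(x, y) \<in> A \<Longrightarrow> (x', y') \<in> A \<Longrightarrow> (x + x', y + y') \<in> A"
    using subspace_add[OF A, of "(x, y)" "(x', y')"] by simp
  show "(x, y) \<in> A \<Longrightarrow> (x', y') \<in> A \<Longrightarrow> (x - x', y - y') \<in> A"
    using subspace_diff[OF A, of "(x, y)" "(x', y')"] by simp
  show "(x, y) \<in> A \<Longrightarrow> (r *\<^sub>R x, r *\<^sub>R y) \<in> A"
    using subspace_scale[OF A, of "(x, y)" r] by simp
  show "(x, y) \<in> A \<Longrightarrow> (c *\<^sub>C x, c *\<^sub>C y) \<in> A"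
    using C[of "(x, y)" c] by (simp add: scaleC_prod_def)
  show "(0, 0) \<in> A"
    using subspace_0[OF A] by (simp add: zero_prod_def)
qed

lemma linear_relationI:
  assumes "(0, 0) \<in> A"
    and "\<And>x y x' y'. (x, y) \<in> A \<Longrightarrow> (x', y') \<in> A \<Longrightarrow> (x + x', y + y') \<in> A"
    and "\<And>c x y. (x, y) \<in> A \<Longrightarrow> (c *\<^sub>C x, c *\<^sub>C y) \<in> A"
  shows "linear_relation A"
  using assms unfolding linear_relation_def csubspace_def subspace_def
  by (auto simp: zero_prod_def scaleC_prod_def scaleR_scaleC)

lemma dissipative_inner:
  "dissipative A \<longleftrightarrow> linear_relation A \<and> (\<forall>x y. (x, y) \<in> A \<longrightarrow> inner x y \<le> 0)"
  by (auto simp: dissipative_def inner_eq_Re_cinner)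

lemma skew_symmetric_inner:
  "skew_symmetric A \<longleftrightarrow> linear_relation A \<and> (\<forall>x y. (x, y) \<in> A \<longrightarrow> inner x y = 0)"
  by (auto simp: skew_symmetric_def inner_eq_Re_cinner)

text \<open>Expanding \<open>\<parallel>x - h y\<parallel>\<^sup>2\<close>, the cross term \<open>-2 h Re \<langle>x, y\<rangle>\<close> is nonnegative. The first bound makes
  resolvents contractive, and both together make the range of \<open>I - h A\<close> closed.\<close>

lemma dissipative_norms:
  assumes "dissipative A" "(x, y) \<in> A" "0 \<le> h"
  shows "norm x \<le> norm (x - h *\<^sub>R y)" "h * norm y \<le> norm (x - h *\<^sub>R y)"
proof -
  have "h * inner x y \<le> 0"
    using assms by (auto simp: dissipative_inner mult_nonneg_nonpos)
  then have "(norm x)\<^sup>2 + (h * norm y)\<^sup>2 \<le> (norm (x - h *\<^sub>R y))\<^sup>2"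
    unfolding power_mult_distrib power2_norm_eq_inner
    by (simp add: inner_diff inner_commute algebra_simps power2_eq_square)
  then have "(norm x)\<^sup>2 \<le> (norm (x - h *\<^sub>R y))\<^sup>2" "(h * norm y)\<^sup>2 \<le> (norm (x - h *\<^sub>R y))\<^sup>2"
    using zero_le_power2[of "norm x"] zero_le_power2[of "h * norm y"] by linarith+
  from this[THEN power2_le_imp_le]
  show "norm x \<le> norm (x - h *\<^sub>R y)" "h * norm y \<le> norm (x - h *\<^sub>R y)"
    by simp_all
qed

text \<open>Real and complex orthogonality to a complex subspace agree, so that real inner products suffice for
  computing adjoints.\<close>

lemma op_adjoint_inner:
  assumes "linear_relation A"
  shows "(y, z) \<in> op_adjoint A \<longleftrightarrow> (\<forall>x w. (x, w) \<in> A \<longrightarrow> inner w y = inner x z)"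
proof
  assume *: "\<forall>x w. (x, w) \<in> A \<longrightarrow> inner w y = inner x z"
  have "cinner p (- z, y) = 0" if "p \<in> A" for p
  proof (rule cinner_eq_0_if_inner_eq_0_on[OF _ that])
    show "c *\<^sub>C p \<in> A" if "p \<in> A" for c p
      using assms that by (simp add: linear_relation_def csubspace_def)
    show "inner p (- z, y) = 0" if "p \<in> A" for p
      using * that by (cases p) simp
  qed
  then show "(y, z) \<in> op_adjoint A"
    by (fastforce simp: op_adjoint_def cinner_prod_def cinner_simps)
qed (auto simp: op_adjoint_def inner_eq_Re_cinner)

lemma op_adjoint_iff:
  "(y, z) \<in> op_adjoint A \<longleftrightarrow> (\<forall>x w. (x, w) \<in> A \<longrightarrow> cinner w y = cinner x z)"
  by (auto simp: op_adjoint_def)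

lemma linear_relation_op_adjoint: "linear_relation (op_adjoint A)"
  by (rule linear_relationI)
    (simp_all add: op_adjoint_iff cinner_simps cinner_add_right cinner_scaleC_right)

lemma op_uminus_iff: "(x, y) \<in> op_uminus A \<longleftrightarrow> (x, - y) \<in> A"
  for y :: "'a::group_add"
  by (auto simp: op_uminus_def) force

lemma op_adjoint_uminus: "op_adjoint (op_uminus A) = op_uminus (op_adjoint A)"
proof -
  have "(y, z) \<in> op_adjoint (op_uminus A) \<longleftrightarrow> (y, z) \<in> op_uminus (op_adjoint A)" for y z
  proof -
    have "(\<forall>x w. (x, - w) \<in> A \<longrightarrow> cinner w y = cinner x z) \<longleftrightarrow>
        (\<forall>x w. (x, w) \<in> A \<longrightarrow> cinner (- w) y = cinner x z)"
      by (metis minus_minus)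
    also have "\<dots> \<longleftrightarrow> (\<forall>x w. (x, w) \<in> A \<longrightarrow> cinner w y = cinner x (- z))"
      by (simp add: cinner_simps) (metis minus_minus)
    finally show ?thesis by (simp add: op_adjoint_iff op_uminus_iff)
  qed
  then show ?thesis by auto
qed

lemma linear_relation_op_uminus:
  fixes A :: "('a::complex_inner \<times> 'a) set"
  assumes "linear_relation A"
  shows "linear_relation (op_uminus A)"
proof (rule linear_relationI)
  fix c x y assume "(x, y) \<in> op_uminus A"
  then have "(c *\<^sub>C x, c *\<^sub>C (- y)) \<in> A"
    by (simp add: op_uminus_iff linear_relation_scaleC[OF assms])
  moreover have "c *\<^sub>C (- y) = - (c *\<^sub>C y)"
    using scaleC_add_right[of c "- y" y] scaleC_add_right[of c 0 "0 :: 'a"]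
    by (simp add: eq_neg_iff_add_eq_0)
  ultimately show "(c *\<^sub>C x, c *\<^sub>C y) \<in> op_uminus A" by (simp add: op_uminus_iff)
next
  fix x y x' y' assume "(x, y) \<in> op_uminus A" "(x', y') \<in> op_uminus A"
  then show "(x + x', y + y') \<in> op_uminus A"
    using linear_relation_add[OF assms, of x "- y" x' "- y'"] by (simp add: op_uminus_iff)
qed (simp add: op_uminus_iff linear_relation_0[OF assms])

lemma Domain_op_uminus: "Domain (op_uminus A) = Domain A"
  for A :: "('a \<times> 'b::group_add) set"
  by (auto simp: Domain_iff op_uminus_iff) (metis minus_minus)

lemma closed_op_uminus:
  fixes A :: "('a::topological_space \<times> 'b::real_normed_vector) set"
  assumes "closed A"
  shows "closed (op_uminus A)"
proof -
  have "op_uminus A = (\<lambda>p. (fst p, - snd p)) -` A"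
    by (auto simp: op_uminus_iff)
  moreover have "closed ((\<lambda>p. (fst p, - snd p)) -` A)"
    by (intro closed_vimage assms continuous_intros)
  ultimately show ?thesis by simp
qed

text \<open>Skew-symmetry is two-sided dissipativity, which reduces groups to pairs of semigroups.\<close>

lemma skew_symmetric_iff_dissipative:
  "skew_symmetric A \<longleftrightarrow> dissipative A \<and> dissipative (op_uminus A)"
proof -
  have "(\<forall>x y. (x, y) \<in> op_uminus A \<longrightarrow> inner x y \<le> 0) \<longleftrightarrow> (\<forall>x y. (x, y) \<in> A \<longrightarrow> 0 \<le> inner x y)"
    by (metis op_uminus_iff inner_minus_right minus_minus neg_le_0_iff_le)
  then show ?thesis
    unfolding skew_symmetric_inner dissipative_inner
    by (auto intro: linear_relation_op_uminus antisym)
qed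

section \<open>Families of commuting linear contractions\<close>

definition linear_contraction :: "('a::complex_inner \<Rightarrow> 'a) \<Rightarrow> bool" where
  "linear_contraction P \<longleftrightarrow> bounded_clinear P \<and> (\<forall>x. norm (P x) \<le> norm x)"

lemma linear_contractionI:
  assumes add: "\<And>x y. P (x + y) = P x + P y" and scale: "\<And>c x. P (c *\<^sub>C x) = c *\<^sub>C P x"
    and bound: "\<And>x. norm (P x) \<le> norm x"
  shows "linear_contraction P"
proof -
  have "bounded_linear P"
    by (rule bounded_linear_intro[where K = 1]) (simp_all add: add scale bound scaleR_scaleC)
  then show ?thesis by (simp add: linear_contraction_def bounded_clinear_def scale bound)
qed

lemma linear_contractionD:
  assumes "linear_contraction P"
  shows linear_contraction_add: "P (x + y) = P x + P y"
    and linear_contraction_diff: "P (x - y) = P x - P y"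
    and linear_contraction_scaleR: "P (r *\<^sub>R x) = r *\<^sub>R P x"
    and linear_contraction_scaleC: "P (c *\<^sub>C x) = c *\<^sub>C P x"
    and linear_contraction_norm: "norm (P x) \<le> norm x"
proof -
  have "bounded_linear P" using assms by (simp add: linear_contraction_def bounded_clinear_def)
  then interpret bounded_linear P .
  show "P (x + y) = P x + P y" "P (x - y) = P x - P y" "P (r *\<^sub>R x) = r *\<^sub>R P x"
    by (rule add diff scaleR)+
qed (use assms in \<open>auto simp: linear_contraction_def bounded_clinear_def\<close>)

lemma linear_contraction_id: "linear_contraction id"
  by (rule linear_contractionI) auto

lemma linear_contraction_comp:
  assumes "linear_contraction P" "linear_contraction Q"
  shows "linear_contraction (P \<circ> Q)"
proof (rule linear_contractionI)
  show "norm ((P \<circ> Q) x) \<le> norm x" for x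
    using linear_contraction_norm[OF assms(1), of "Q x"] linear_contraction_norm[OF assms(2), of x]
    by simp
qed (use assms in \<open>auto simp: linear_contraction_add linear_contraction_scaleC\<close>)

lemma linear_contraction_funpow:
  assumes "linear_contraction P"
  shows "linear_contraction (P ^^ n)"
proof (induction n)
  case 0
  show ?case by (simp only: funpow.simps(1) linear_contraction_id)
next
  case (Suc n)
  show ?case unfolding funpow.simps(2) by (rule linear_contraction_comp[OF assms Suc])
qed

lemma tendsto_scaleC:
  fixes x :: "'a::complex_inner"
  assumes "(f \<longlongrightarrow> x) F"
  shows "((\<lambda>n. c *\<^sub>C f n) \<longlongrightarrow> c *\<^sub>C x) F"
proof -
  have "bounded_linear (\<lambda>x :: 'a. c *\<^sub>C x)"
    by (rule bounded_linear_intro[where K = "cmod c"])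
      (simp_all add: scaleC_add_right scaleR_scaleC scaleC_scaleC mult.commute norm_scaleC)
  from bounded_linear.tendsto[OF this assms] show ?thesis .
qed

lemma linear_contraction_limit:
  assumes P: "\<And>k :: nat. linear_contraction (P k)" and lim: "\<And>x. (\<lambda>k. P k x) \<longlonglongrightarrow> Q x"
  shows "linear_contraction Q"
proof (rule linear_contractionI)
  fix x y c
  show "Q (x + y) = Q x + Q y"
    using LIMSEQ_unique[OF lim[of "x + y"]] tendsto_add[OF lim[of x] lim[of y]]
    by (simp add: linear_contraction_add[OF P])
  show "Q (c *\<^sub>C x) = c *\<^sub>C Q x"
    using LIMSEQ_unique[OF lim[of "c *\<^sub>C x"]] tendsto_scaleC[OF lim[of x], of c]
    by (simp add: linear_contraction_scaleC[OF P])
  show "norm (Q x) \<le> norm x"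
    by (rule LIMSEQ_le_const2[OF tendsto_norm[OF lim]]) (simp add: linear_contraction_norm[OF P])
qed

text \<open>Contractions are equicontinuous, so that strong convergence may be combined with convergence of the
  argument.\<close>

lemma contraction_tendsto_apply:
  assumes P: "\<forall>\<^sub>F h in F. linear_contraction (P h)"
    and "((\<lambda>h. P h v) \<longlongrightarrow> w) F" and "(f \<longlongrightarrow> v) F"
  shows "((\<lambda>h. P h (f h)) \<longlongrightarrow> w) F"
proof -
  have "((\<lambda>h. norm (f h - v)) \<longlongrightarrow> 0) F"
    using assms(3) by (simp add: LIM_zero tendsto_norm_zero)
  moreover have "\<forall>\<^sub>F h in F. norm (P h (f h) - P h v) \<le> norm (f h - v)"
    using P
  proof eventually_elim
    case (elim h)
    show ?case using linear_contraction_norm[OF elim, of "f h - v"] linear_contraction_diff[OF elim] by simp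
  qed
  ultimately have "((\<lambda>h. P h (f h) - P h v) \<longlongrightarrow> 0) F"
    by (rule Lim_null_comparison[rotated])
  from tendsto_add[OF this assms(2)] show ?thesis by simp
qed

lemma closure_approx:
  fixes D :: "'a::real_normed_vector set"
  assumes "closure D = UNIV" "0 < e"
  obtains x' where "x' \<in> D" "norm (x - x') < e"
  using assms closure_approachable[of x D] by (auto simp: dist_norm norm_minus_commute)

lemma norm_triangle_3: "norm (a + b + c) \<le> norm a + norm b + norm c"
  for a b c :: "'a::real_normed_vector"
  using norm_triangle_ineq[of "a + b" c] norm_triangle_ineq[of a b] by linarith

lemma contraction_tendsto_id_dense:
  assumes P: "\<forall>\<^sub>F h in F. linear_contraction (P h)" and D: "closure D = UNIV"
    and lim: "\<And>x. x \<in> D \<Longrightarrow> ((\<lambda>h. P h x) \<longlongrightarrow> x) F"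
  shows "((\<lambda>h. P h x) \<longlongrightarrow> x) F"
proof (rule tendstoI)
  fix e :: real assume "0 < e"
  then obtain x' where x': "x' \<in> D" "norm (x - x') < e / 3"
    using closure_approx[OF D, of "e / 3" x] by auto
  have "\<forall>\<^sub>F h in F. dist (P h x') x' < e / 3"
    using lim[OF x'(1)] \<open>0 < e\<close> by (intro tendstoD) auto
  with P show "\<forall>\<^sub>F h in F. dist (P h x) x < e"
  proof eventually_elim
    case (elim h)
    have "P h x - x = P h (x - x') + (P h x' - x') + (x' - x)"
      by (simp add: linear_contraction_diff[OF elim(1)])
    then have "norm (P h x - x) \<le> norm (P h (x - x')) + norm (P h x' - x') + norm (x' - x)"
      by (simp only: norm_triangle_3)
    then show ?case
      using linear_contraction_norm[OF elim(1), of "x - x'"] elim(2) x'(2)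
      by (simp add: dist_norm norm_minus_commute)
  qed
qed

lemma contraction_convergent_dense:
  fixes P :: "nat \<Rightarrow> 'a::chilbert_space \<Rightarrow> 'a"
  assumes P: "\<And>k. linear_contraction (P k)" and D: "closure D = UNIV"
    and conv: "\<And>x. x \<in> D \<Longrightarrow> convergent (\<lambda>k. P k x)"
  shows "convergent (\<lambda>k. P k x)"
proof (rule Cauchy_convergent, rule CauchyI)
  fix e :: real assume "0 < e"
  then obtain x' where x': "x' \<in> D" "norm (x - x') < e / 3"
    using closure_approx[OF D, of "e / 3" x] by auto
  have "Cauchy (\<lambda>k. P k x')" using conv[OF x'(1)] by (rule convergent_Cauchy)
  then obtain M where M: "\<And>m n. m \<ge> M \<Longrightarrow> n \<ge> M \<Longrightarrow> norm (P m x' - P n x') < e / 3"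
    using CauchyD[of "\<lambda>k. P k x'" "e / 3"] \<open>0 < e\<close> by auto
  have "norm (P m x - P n x) < e" if "m \<ge> M" "n \<ge> M" for m n
  proof -
    have "P m x - P n x = P m (x - x') + (P m x' - P n x') + P n (x' - x)"
      by (simp add: linear_contraction_diff[OF P])
    then have "norm (P m x - P n x) \<le> norm (P m (x - x')) + norm (P m x' - P n x') + norm (P n (x' - x))"
      by (simp only: norm_triangle_3)
    then show ?thesis
      using linear_contraction_norm[OF P, of m "x - x'"] linear_contraction_norm[OF P, of n "x' - x"]
        M[OF that] x'(2) by (simp add: norm_minus_commute)
  qed
  then show "\<exists>M. \<forall>m\<ge>M. \<forall>n\<ge>M. norm (P m x - P n x) < e" by blast
qed

text \<open>Writing \<open>P\<^bsup>n+1\<^esup> x - Q\<^bsup>n+1\<^esup> x = P (P\<^sup>n x - Q\<^sup>n x) + Q\<^sup>n (P x - Q x)\<close>, each step adds at most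
  \<open>\<parallel>P x - Q x\<parallel>\<close>: local errors accumulate only linearly.\<close>

lemma contraction_power_diff:
  assumes P: "linear_contraction P" and Q: "linear_contraction Q"
    and comm: "\<And>x. P (Q x) = Q (P x)"
  shows "norm ((P ^^ n) x - (Q ^^ n) x) \<le> n * norm (P x - Q x)"
proof (induction n)
  case (Suc n)
  have Qn: "linear_contraction (Q ^^ n)" by (rule linear_contraction_funpow[OF Q])
  have "P ((Q ^^ n) x) = (Q ^^ n) (P x)"
    by (induction n) (simp_all add: comm)
  then have "(P ^^ Suc n) x - (Q ^^ Suc n) x = P ((P ^^ n) x - (Q ^^ n) x) + (Q ^^ n) (P x - Q x)"
    by (simp add: linear_contraction_diff[OF P] linear_contraction_diff[OF Qn] funpow_swap1)
  also have "norm \<dots> \<le> norm ((P ^^ n) x - (Q ^^ n) x) + norm (P x - Q x)"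
    by (intro norm_triangle_mono linear_contraction_norm P Qn)
  finally show ?case using Suc by (simp add: algebra_simps)
qed simp

text \<open>Product rule for derivatives at \<open>0\<close>. Here and below \<^const>\<open>semigroup_generator\<close> is used for
  arbitrary families as the set of pairs of a point and the right derivative of its orbit at \<open>0\<close>.\<close>

lemma semigroup_generator_comp:
  assumes P: "\<And>h. h > 0 \<Longrightarrow> linear_contraction (P h)"
    and "((\<lambda>h. P h z) \<longlongrightarrow> z) (at_right 0)"
    and xy: "(x, y) \<in> semigroup_generator P" and xz: "(x, z) \<in> semigroup_generator Q"
  shows "(x, y + z) \<in> semigroup_generator (\<lambda>h. P h \<circ> Q h)"
proof -
  have P': "\<forall>\<^sub>F h in at_right 0. linear_contraction (P h)"
    by (auto simp: eventually_at_filter intro!: always_eventually P)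
  have "((\<lambda>h. P h ((Q h x - x) /\<^sub>R h)) \<longlongrightarrow> z) (at_right 0)"
    using xz by (intro contraction_tendsto_apply[OF P' assms(2)]) (simp add: semigroup_generator_def)
  with xy have "((\<lambda>h. (P h x - x) /\<^sub>R h + P h ((Q h x - x) /\<^sub>R h)) \<longlongrightarrow> y + z) (at_right 0)"
    by (intro tendsto_add) (simp_all add: semigroup_generator_def)
  moreover have "\<forall>\<^sub>F h in at_right 0. (P h x - x) /\<^sub>R h + P h ((Q h x - x) /\<^sub>R h) = (P h (Q h x) - x) /\<^sub>R h"
    using P'
  proof eventually_elim
    case (elim h)
    show ?case
      unfolding linear_contraction_scaleR[OF elim] linear_contraction_diff[OF elim]
        scaleR_add_right[symmetric] by simp
  qed
  ultimately show ?thesis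
    unfolding semigroup_generator_def comp_def mem_Collect_eq prod.case
    by (rule Lim_transform_eventually)
qed

lemma semigroup_generator_rescale:
  assumes "(x, y) \<in> semigroup_generator P" "0 < a"
  shows "(x, a *\<^sub>R y) \<in> semigroup_generator (\<lambda>h. P (h * a))"
proof -
  have "filterlim (\<lambda>h. h * a) (at_right 0) (at_right 0)"
    unfolding filterlim_at
    using assms(2) by (auto simp: eventually_at_filter intro!: always_eventually tendsto_eq_intros)
  then have "((\<lambda>h. (P (h * a) x - x) /\<^sub>R (h * a)) \<longlongrightarrow> y) (at_right 0)"
    using assms(1) unfolding semigroup_generator_def
    by (auto intro: filterlim_compose[of "\<lambda>t. (P t x - x) /\<^sub>R t"] simp del: inverse_mult_distrib)
  then have "((\<lambda>h. a *\<^sub>R ((P (h * a) x - x) /\<^sub>R (h * a))) \<longlongrightarrow> a *\<^sub>R y) (at_right 0)"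
    by (intro tendsto_intros)
  moreover have "a *\<^sub>R ((P (h * a) x - x) /\<^sub>R (h * a)) = (P (h * a) x - x) /\<^sub>R h" for h
    using assms(2) by simp
  ultimately show ?thesis by (simp only: semigroup_generator_def) simp
qed

text \<open>Both families at time \<open>h\<close> are \<open>2^k\<close>-fold iterates of their values at \<open>h / 2^k\<close>. Equal tangents make the
  local difference \<open>o(h / 2^k)\<close>, so that after \<open>2^k\<close> commuting steps the total difference still tends
  to \<open>0\<close>.\<close>

lemma contraction_families_eq:
  assumes P: "\<And>h. h > 0 \<Longrightarrow> linear_contraction (P h)" and Q: "\<And>h. h > 0 \<Longrightarrow> linear_contraction (Q h)"
    and comm: "\<And>h x. h > 0 \<Longrightarrow> P h (Q h x) = Q h (P h x)"
    and P2: "\<And>h. h > 0 \<Longrightarrow> P (2 * h) = P h \<circ> P h"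
    and Q2: "\<And>h. h > 0 \<Longrightarrow> Q (2 * h) = Q h \<circ> Q h"
    and D: "closure D = UNIV"
    and tangent: "\<And>x. x \<in> D \<Longrightarrow> \<exists>y. (x, y) \<in> semigroup_generator P \<and> (x, y) \<in> semigroup_generator Q"
    and "h > 0"
  shows "P h = Q h"
proof
  have dyadic: "R h = R (h / 2 ^ k) ^^ (2 ^ k)"
    if "\<And>h. h > 0 \<Longrightarrow> R (2 * h) = R h \<circ> R h" for R :: "real \<Rightarrow> 'a \<Rightarrow> 'a" and k
  proof (induction k)
    case (Suc k)
    have "R (h / 2 ^ k) = R (h / 2 ^ Suc k) ^^ 2"
      using that[of "h / 2 ^ Suc k"] \<open>h > 0\<close> by (simp add: numeral_2_eq_2 comp_def)
    from Suc[unfolded this funpow_mult] show ?case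
      by (simp only: power_Suc)
  qed simp
  have P_dyadic: "P h = P (h / 2 ^ k) ^^ (2 ^ k)" for k
    by (rule dyadic) (rule P2)
  have Q_dyadic: "Q h = Q (h / 2 ^ k) ^^ (2 ^ k)" for k
    by (rule dyadic) (rule Q2)
  have eq: "P h x = Q h x" if x: "x \<in> D" for x
  proof -
    obtain y where y: "(x, y) \<in> semigroup_generator P" "(x, y) \<in> semigroup_generator Q"
      using tangent[OF x] by blast
    have "((\<lambda>r. (P r x - x) /\<^sub>R r - (Q r x - x) /\<^sub>R r) \<longlongrightarrow> y - y) (at_right 0)"
      using y by (intro tendsto_diff) (auto simp: semigroup_generator_def)
    then have "((\<lambda>r. norm ((P r x - Q r x) /\<^sub>R r)) \<longlongrightarrow> 0) (at_right 0)"
      by (intro tendsto_norm_zero) (simp add: algebra_simps)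
    moreover have "filterlim (\<lambda>k. h / 2 ^ k) (at_right 0) sequentially"
    proof -
      have "(\<lambda>k. h * (1 / 2) ^ k) \<longlonglongrightarrow> h * 0"
        by (intro tendsto_intros LIMSEQ_power_zero) auto
      then show ?thesis
        using \<open>h > 0\<close> by (auto simp: filterlim_at power_divide)
    qed
    ultimately have "(\<lambda>k. norm ((P (h / 2 ^ k) x - Q (h / 2 ^ k) x) /\<^sub>R (h / 2 ^ k))) \<longlonglongrightarrow> 0"
      by (rule filterlim_compose)
    from tendsto_mult[OF tendsto_const[of h] this]
    have "(\<lambda>k. h * norm ((P (h / 2 ^ k) x - Q (h / 2 ^ k) x) /\<^sub>R (h / 2 ^ k))) \<longlonglongrightarrow> 0" by simp
    moreover have "norm (P h x - Q h x) \<le> h * norm ((P (h / 2 ^ k) x - Q (h / 2 ^ k) x) /\<^sub>R (h / 2 ^ k))" for k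
    proof -
      have "norm (P h x - Q h x) \<le> 2 ^ k * norm (P (h / 2 ^ k) x - Q (h / 2 ^ k) x)"
        using contraction_power_diff[of "P (h / 2 ^ k)" "Q (h / 2 ^ k)" "2 ^ k" x]
          P Q comm \<open>h > 0\<close> unfolding P_dyadic[of k, symmetric] Q_dyadic[of k, symmetric] by simp
      also have "\<dots> = h * norm ((P (h / 2 ^ k) x - Q (h / 2 ^ k) x) /\<^sub>R (h / 2 ^ k))"
        using \<open>h > 0\<close> by simp
      finally show ?thesis .
    qed
    ultimately have "norm (P h x - Q h x) \<le> 0"
      by (intro LIMSEQ_le_const) auto
    then show ?thesis by simp
  qed
  fix x
  have "continuous_on UNIV (P h)" "continuous_on UNIV (Q h)"
    using P[OF \<open>h > 0\<close>] Q[OF \<open>h > 0\<close>]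
    by (auto simp: linear_contraction_def bounded_clinear_def intro: linear_continuous_on)
  then have "closed {x. P h x = Q h x}"
    by (intro closed_Collect_eq)
  then show "P h x = Q h x"
    using closure_minimal[of D "{x. P h x = Q h x}"] eq D by auto
qed

section \<open>Contraction semigroups from the backward Euler scheme\<close>

text \<open>The resolvent \<open>(I - h A)\<^sup>-\<^sup>1\<close>. At \<open>h = 0\<close> the description would be meaningful only on the domain of
  \<open>A\<close>; the identity is the value that makes all formulas below hold for \<open>h \<ge> 0\<close>.\<close>

definition backward_euler :: "('a::chilbert_space \<times> 'a) set \<Rightarrow> real \<Rightarrow> 'a \<Rightarrow> 'a" where
  "backward_euler A h u = (if h = 0 then u else THE x. \<exists>y. (x, y) \<in> A \<and> x - h *\<^sub>R y = u)"

text \<open>Dyadic step numbers make successive approximations comparable, since each step is halved.\<close>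

definition euler_semigroup :: "('a::chilbert_space \<times> 'a) set \<Rightarrow> real \<Rightarrow> 'a \<Rightarrow> 'a" where
  "euler_semigroup A t x = lim (\<lambda>k. (backward_euler A (t / 2 ^ k) ^^ (2 ^ k)) x)"

text \<open>The range condition is the usual definition of an m-dissipative operator.\<close>

locale m_dissipative =
  fixes A :: "('a::chilbert_space \<times> 'a) set"
  assumes dissipative: "dissipative A"
    and dense: "closure (Domain A) = UNIV"
    and range: "h > 0 \<Longrightarrow> \<exists>x y. (x, y) \<in> A \<and> x - h *\<^sub>R y = u"
begin

abbreviation "J \<equiv> backward_euler A"
abbreviation "T \<equiv> euler_semigroup A"

lemma linear: "linear_relation A"
  using dissipative by (simp add: dissipative_def)

lemma J_0 [simp]: "J 0 = id"
  by (simp add: backward_euler_def fun_eq_iff)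

lemma J_eq:
  assumes "(x, y) \<in> A" "h > 0"
  shows "J h (x - h *\<^sub>R y) = x"
proof -
  have "x' = x" if "(x', y') \<in> A" "x' - h *\<^sub>R y' = x - h *\<^sub>R y" for x' y'
  proof -
    have "(x' - x, y' - y) \<in> A" using linear_relation_diff[OF linear that(1) assms(1)] .
    moreover have "(x' - x) - h *\<^sub>R (y' - y) = 0" using that(2) by (simp add: algebra_simps)
    ultimately have "norm (x' - x) \<le> 0"
      using dissipative_norms(1)[OF dissipative, of "x' - x" "y' - y" h] assms(2)
      by (metis norm_zero less_imp_le)
    then show ?thesis by simp
  qed
  then show ?thesis
    using assms by (auto simp: backward_euler_def intro!: the_equality)
qed

lemma J_graph:
  assumes "h > 0"
  obtains y where "(J h u, y) \<in> A" "J h u - h *\<^sub>R y = u"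
  using range[OF assms, of u] J_eq assms by fastforce

lemma J_contraction:
  assumes "h \<ge> 0"
  shows "linear_contraction (J h)"
proof (cases "h = 0")
  case True
  then show ?thesis by (simp add: linear_contraction_id)
next
  case False
  then have h: "h > 0" using assms by simp
  show ?thesis
  proof (rule linear_contractionI)
    fix u v c
    obtain y z where y: "(J h u, y) \<in> A" "J h u - h *\<^sub>R y = u"
      and z: "(J h v, z) \<in> A" "J h v - h *\<^sub>R z = v"
      using J_graph[OF h] by metis
    have "(J h u + J h v) - h *\<^sub>R (y + z) = (J h u - h *\<^sub>R y) + (J h v - h *\<^sub>R z)"
      by (simp add: algebra_simps)
    then show "J h (u + v) = J h u + J h v"
      using J_eq[OF linear_relation_add[OF linear y(1) z(1)] h] unfolding y(2) z(2) by simp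
    have "c *\<^sub>C J h u - h *\<^sub>R c *\<^sub>C y = c *\<^sub>C (J h u - h *\<^sub>R y)"
      using scaleC_add_right[of c "J h u - h *\<^sub>R y" "h *\<^sub>R y"]
      by (simp add: scaleR_scaleC scaleC_scaleC mult.commute)
    then show "J h (c *\<^sub>C u) = c *\<^sub>C J h u"
      using J_eq[OF linear_relation_scaleC[OF linear y(1)] h, of c] unfolding y(2) by simp
    show "norm (J h u) \<le> norm u"
      using dissipative_norms(1)[OF dissipative y(1) assms] unfolding y(2) .
  qed
qed

lemma J_power_contraction: "h \<ge> 0 \<Longrightarrow> linear_contraction (J h ^^ n)"
  by (intro linear_contraction_funpow J_contraction)

text \<open>A map that commutes with \<open>A\<close> commutes with its resolvents. This is stated for arbitrary contractions
  because it is used for the resolvents of \<open>A\<close> themselves, for the semigroup, and for the semigroup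
  generated by \<open>-A\<close>.\<close>

lemma J_commute:
  assumes L: "linear_contraction L" and inv: "\<And>x y. (x, y) \<in> A \<Longrightarrow> (L x, L y) \<in> A" and "h \<ge> 0"
  shows "J h (L u) = L (J h u)"
proof (cases "h = 0")
  case False
  then have h: "h > 0" using assms by simp
  obtain y where y: "(J h u, y) \<in> A" "J h u - h *\<^sub>R y = u"
    using J_graph[OF h] .
  have "L (J h u) - h *\<^sub>R L y = L u"
    using arg_cong[OF y(2), of L]
    by (simp only: linear_contraction_diff[OF L] linear_contraction_scaleR[OF L])
  then show ?thesis using J_eq[OF inv[OF y(1)] h] by simp
qed simp

lemma J_step:
  assumes "(x, y) \<in> A" "h \<ge> 0"
  shows "J h x = x + h *\<^sub>R J h y"
proof (cases "h = 0")
  case False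
  then have "J h (x - h *\<^sub>R y) = x" using J_eq assms by simp
  then show ?thesis
    using J_contraction[OF assms(2)]
    by (simp only: linear_contraction_diff linear_contraction_scaleR) (simp add: algebra_simps)
qed simp

lemma J_invariant:
  assumes "(x, y) \<in> A" "h \<ge> 0"
  shows "(J h x, J h y) \<in> A"
proof (cases "h = 0")
  case False
  then have h: "h > 0" using assms by simp
  obtain z where z: "(J h x, z) \<in> A" "J h x - h *\<^sub>R z = x"
    using J_graph[OF h] .
  have "h *\<^sub>R z = J h x - (J h x - h *\<^sub>R z)" by simp
  also have "\<dots> = h *\<^sub>R J h y" unfolding z(2) by (simp add: J_step[OF assms])
  finally have "z = J h y" using h by simp
  then show ?thesis using z(1) by simp
qed (use assms in simp)

lemma J_J_commute: "h \<ge> 0 \<Longrightarrow> k \<ge> 0 \<Longrightarrow> J h (J k x) = J k (J h x)"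
  by (intro J_commute J_contraction J_invariant)

lemma power_step:
  assumes "(x, y) \<in> A" "h \<ge> 0"
  shows "norm ((J h ^^ n) x - x) \<le> n * h * norm y"
proof -
  have "linear_contraction (id :: 'a \<Rightarrow> 'a)" by (rule linear_contraction_id)
  from contraction_power_diff[OF J_contraction[OF assms(2)] this, of n x]
  have "norm ((J h ^^ n) x - x) \<le> n * norm (J h x - x)" by simp
  also have "\<dots> \<le> n * (h * norm y)"
    using J_step[OF assms] linear_contraction_norm[OF J_contraction[OF assms(2)], of y] assms(2)
    by (intro mult_left_mono) (auto intro: mult_left_mono)
  finally show ?thesis by simp
qed

text \<open>From \<open>J\<^sub>h\<^sup>n x - x = h \<Sum>\<^bsub>j=1\<^esub>\<^sup>n J\<^sub>h\<^sup>j y\<close> with \<open>y = A x\<close>, the deviation from the tangent is governed by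
  \<open>J\<^sub>h\<^sup>j y - y\<close>. Since \<open>y\<close> need not lie in the domain of \<open>A\<close>, it is compared with a nearby point \<open>y'\<close>
  that does. The bound depends on \<open>n\<close> and \<open>h\<close> only through \<open>n h\<close> and so passes to the limit.\<close>

lemma euler_tangent:
  assumes xy: "(x, y) \<in> A" and yz: "(y', z') \<in> A" and h: "h \<ge> 0"
  shows "norm ((J h ^^ n) x - x - (n * h) *\<^sub>R y) \<le> n * h * (2 * norm (y - y') + n * h * norm z')"
proof (induction n)
  case (Suc n)
  let ?P = "\<lambda>n. J h ^^ n"
  let ?e = "2 * norm (y - y') + Suc n * h * norm z'"
  note P = J_power_contraction[OF h]
  have "?P (Suc n) x = ?P n x + h *\<^sub>R ?P (Suc n) y"
    by (simp add: funpow_swap1 J_step[OF xy h] linear_contraction_add[OF P] linear_contraction_scaleR[OF P])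
  then have split: "?P (Suc n) x - x - (Suc n * h) *\<^sub>R y
      = (?P n x - x - (n * h) *\<^sub>R y) + h *\<^sub>R (?P (Suc n) y - y)"
    by (simp add: algebra_simps)
  have "?P (Suc n) y - y = ?P (Suc n) (y - y') + (?P (Suc n) y' - y') + (y' - y)"
    by (simp only: linear_contraction_diff[OF P]) simp
  then have "norm (?P (Suc n) y - y)
      \<le> norm (?P (Suc n) (y - y')) + norm (?P (Suc n) y' - y') + norm (y' - y)"
    by (simp only: norm_triangle_3)
  also have "\<dots> \<le> norm (y - y') + Suc n * h * norm z' + norm (y - y')"
    using linear_contraction_norm[OF P, of "Suc n" "y - y'"] power_step[OF yz h, of "Suc n"]
    by (intro add_mono) (simp_all add: norm_minus_commute)
  finally have "norm (h *\<^sub>R (?P (Suc n) y - y)) \<le> h * ?e"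
    using h by (auto intro!: mult_left_mono)
  moreover have "norm (?P n x - x - (n * h) *\<^sub>R y) \<le> n * h * ?e"
    using Suc.IH
  proof (rule order_trans)
    show "n * h * (2 * norm (y - y') + n * h * norm z') \<le> n * h * ?e"
      using h by (intro mult_left_mono add_left_mono mult_right_mono) auto
  qed
  ultimately have "norm (?P (Suc n) x - x - (Suc n * h) *\<^sub>R y) \<le> n * h * ?e + h * ?e"
    unfolding split by (intro norm_triangle_le) linarith
  also have "\<dots> = Suc n * h * ?e" by (simp add: algebra_simps)
  finally show ?case .
qed simp

text \<open>The operators satisfy \<open>(I - k A)\<^sup>2 = (I - 2 k A) + k\<^sup>2 A\<^sup>2\<close>. Applied to \<open>J\<^sub>k\<^sup>2 x\<close> and followed by \<open>J\<^bsub>2k\<^esub>\<close>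
  this gives \<open>J\<^bsub>2k\<^esub> x - J\<^sub>k\<^sup>2 x = k\<^sup>2 J\<^bsub>2k\<^esub> J\<^sub>k\<^sup>2 A\<^sup>2 x\<close>.\<close>

lemma halving_error:
  assumes xy: "(x, y) \<in> A" and yz: "(y, z) \<in> A" and k: "k \<ge> 0"
  shows "norm (J (2 * k) x - J k (J k x)) \<le> k\<^sup>2 * norm z"
proof (cases "k = 0")
  case False
  let ?K = "\<lambda>x. J k (J k x)"
  have h: "2 * k > 0" "2 * k \<ge> 0" using k False by auto
  note K = J_contraction[OF k]
  have K2: "linear_contraction ?K" using linear_contraction_comp[OF K K] by (simp add: comp_def)
  have step: "?K x = x + k *\<^sub>R J k y + k *\<^sub>R ?K y" "J k y + k *\<^sub>R ?K z = ?K y"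
    if "(x, y) \<in> A" "(y, z) \<in> A" for x y z
    using J_step[OF that(1) k] J_step[OF J_invariant[OF that(1) k] k] J_step[OF that(2) k] 
      J_step[OF J_invariant[OF that(2) k] k]
    by simp_all
  have "x = (w - (2 * k) *\<^sub>R b) + k\<^sup>2 *\<^sub>R c"
    if "w = x + k *\<^sub>R a + k *\<^sub>R b" "a + k *\<^sub>R c = b" for w a b c
    using that(1) unfolding that(2)[symmetric]
    by (simp add: algebra_simps power2_eq_square mult_2 flip: scaleR_2)
  from this[OF step[OF xy yz]]
  have "x = (?K x - (2 * k) *\<^sub>R ?K y) + k\<^sup>2 *\<^sub>R ?K z" .
  then have "J (2 * k) x = J (2 * k) (?K x - (2 * k) *\<^sub>R ?K y) + k\<^sup>2 *\<^sub>R J (2 * k) (?K z)"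
    using linear_contraction_add[OF J_contraction[OF h(2)]] linear_contraction_scaleR[OF J_contraction[OF h(2)]]
    by metis
  also have "J (2 * k) (?K x - (2 * k) *\<^sub>R ?K y) = ?K x"
    by (intro J_eq J_invariant xy k h)
  finally have "norm (J (2 * k) x - ?K x) = k\<^sup>2 * norm (J (2 * k) (?K z))" by simp
  also have "\<dots> \<le> k\<^sup>2 * norm z"
    using linear_contraction_norm[OF J_contraction[OF h(2)], of "?K z"] linear_contraction_norm[OF K2, of z]
    by (intro mult_left_mono) auto
  finally show ?thesis .
qed simp

lemma J_tendsto: "((\<lambda>h. J h x) \<longlongrightarrow> x) (at_right 0)"
proof (rule contraction_tendsto_id_dense[OF _ dense])
  show "\<forall>\<^sub>F h in at_right 0. linear_contraction (J h)"
    by (auto simp: eventually_at_filter J_contraction intro!: always_eventually)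
  fix x assume "x \<in> Domain A"
  then obtain y where y: "(x, y) \<in> A" by auto
  have "\<forall>\<^sub>F h in at_right 0. norm (J h x - x) \<le> h * norm y"
    using power_step[OF y, of _ 1] by (auto simp: eventually_at_filter intro!: always_eventually)
  moreover have "((\<lambda>h. h * norm y) \<longlongrightarrow> 0) (at_right 0)"
    by (intro tendsto_eq_intros) auto
  ultimately show "((\<lambda>h. J h x) \<longlongrightarrow> x) (at_right 0)"
    by (rule LIM_zero_cancel[OF Lim_null_comparison])
qed

text \<open>The vectors \<open>J\<^sub>h J\<^sub>h x\<close> lie in \<open>dom(A\<^sup>2)\<close> and tend to \<open>x\<close>.\<close>

lemma dense_square: "closure {x. \<exists>y z. (x, y) \<in> A \<and> (y, z) \<in> A} = UNIV" (is "closure ?D = _")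
proof -
  have "x \<in> closure ?D" for x
  proof (rule Lim_in_closed_set[of _ "\<lambda>h. J h (J h x)" "at_right 0"])
    have "\<forall>\<^sub>F h in at_right 0. J h (J h x) \<in> ?D"
    proof (auto simp: eventually_at_filter intro!: always_eventually)
      fix h :: real assume h: "0 < h"
      obtain y where y: "(J h x, y) \<in> A" "J h x - h *\<^sub>R y = x"
        using J_graph[OF h] .
      obtain z where z: "(J h (J h x), z) \<in> A" "J h (J h x) - h *\<^sub>R z = J h x"
        using J_graph[OF h] .
      have "h *\<^sub>R z = J h (J h x) - J h x" using z(2) by (simp add: algebra_simps)
      also have "\<dots> \<in> Domain A" 
        using linear_relation_diff[OF linear z(1) y(1)] by auto
      finally obtain w where "(h *\<^sub>R z, w) \<in> A" by auto
      from linear_relation_scaleR[OF linear this, of "1 / h"] h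
      have "(z, (1 / h) *\<^sub>R w) \<in> A" by simp
      then show "\<exists>y. (J h (J h x), y) \<in> A \<and> (\<exists>z. (y, z) \<in> A)" using z(1) by auto
    qed
    then show "\<forall>\<^sub>F h in at_right 0. J h (J h x) \<in> closure ?D"
      by eventually_elim (rule subsetD[OF closure_subset])
    show "((\<lambda>h. J h (J h x)) \<longlongrightarrow> x) (at_right 0)"
      by (rule contraction_tendsto_apply[OF _ J_tendsto J_tendsto])
        (auto simp: eventually_at_filter J_contraction intro!: always_eventually)
  qed auto
  then show ?thesis by blast
qed

text \<open>On \<open>dom(A\<^sup>2)\<close>, passing from \<open>2^k\<close> to \<open>2^(k+1)\<close> steps changes the result by at most \<open>2^k\<close> halving
  errors, which is of order \<open>2^(-k)\<close> and hence summable.\<close>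

lemma euler_convergent:
  assumes t: "t \<ge> 0"
  shows "(\<lambda>k. (J (t / 2 ^ k) ^^ (2 ^ k)) x) \<longlonglongrightarrow> T t x"
proof -
  define e where "e k = J (t / 2 ^ k) ^^ (2 ^ k)" for k :: nat
  have contr: "linear_contraction (e k)" for k
    unfolding e_def using t by (intro J_power_contraction) simp
  have "convergent (\<lambda>k. e k x)"
  proof (rule contraction_convergent_dense[OF contr dense_square])
    fix x assume "x \<in> {x. \<exists>y z. (x, y) \<in> A \<and> (y, z) \<in> A}"
    then obtain y z where yz: "(x, y) \<in> A" "(y, z) \<in> A" by auto
    have bound: "norm (e (Suc k) x - e k x) \<le> t\<^sup>2 * norm z * (1 / 2) ^ k" for k
    proof -
      define h where "h = t / 2 ^ Suc k"
      have h: "h \<ge> 0" "2 * h \<ge> 0" "t / 2 ^ k = 2 * h" using t by (simp_all add: h_def)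
      let ?Q = "J h \<circ> J h"
      have "e (Suc k) = (J h ^^ 2) ^^ (2 ^ k)"
        unfolding e_def h_def[symmetric] by (simp only: funpow_mult power_Suc)
      then have "norm (e (Suc k) x - e k x) = norm ((J (2 * h) ^^ (2 ^ k)) x - (?Q ^^ (2 ^ k)) x)"
        unfolding e_def h(3) by (simp add: numeral_2_eq_2 comp_def norm_minus_commute)
      also have "\<dots> \<le> (2 ^ k :: nat) * norm (J (2 * h) x - ?Q x)"
        by (rule contraction_power_diff) (simp_all add: linear_contraction_comp J_contraction h J_J_commute)
      also have "\<dots> \<le> 2 ^ k * (h\<^sup>2 * norm z)"
        using halving_error[OF yz h(1)] by simp
      also have "\<dots> \<le> t\<^sup>2 * norm z * (1 / 2) ^ k"
      proof -
        have "2 ^ k * (h\<^sup>2 * norm z) = t\<^sup>2 * norm z * (1 / 2) ^ k / 4"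
          by (simp add: h_def power2_eq_square field_simps)
        also have "\<dots> \<le> t\<^sup>2 * norm z * (1 / 2) ^ k" by simp
        finally show ?thesis .
      qed
      finally show ?thesis .
    qed
    have "summable (\<lambda>k. t\<^sup>2 * norm z * (1 / 2) ^ k :: real)"
      by (intro summable_mult summable_geometric) simp
    then have "summable (\<lambda>k. e (Suc k) x - e k x)"
      using bound by (rule summable_comparison_test'[where N = 0])
    then have "convergent (\<lambda>n. \<Sum>k<n. e (Suc k) x - e k x)"
      by (simp add: summable_iff_convergent)
    then have "convergent (\<lambda>n. e 0 x + (\<Sum>k<n. e (Suc k) x - e k x))"
      by (intro convergent_add convergent_const)
    moreover have "e 0 x + (\<Sum>k<n. e (Suc k) x - e k x) = e n x" for n
      by (simp add: sum_lessThan_telescope[of "\<lambda>k. e k x"])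
    ultimately show "convergent (\<lambda>n. e n x)" by simp
  qed
  then show ?thesis
    by (simp add: e_def euler_semigroup_def convergent_LIMSEQ_iff)
qed

lemma T_contraction: "t \<ge> 0 \<Longrightarrow> linear_contraction (T t)"
  by (rule linear_contraction_limit[OF _ euler_convergent]) (simp_all add: J_power_contraction)

lemma T_0 [simp]: "T 0 = id"
proof
  fix x :: 'a
  have "(id ^^ n) x = x" for n by (induction n) auto
  then show "T 0 x = id x"
    using LIMSEQ_unique[OF euler_convergent[of 0 x], of x] by simp
qed

lemma T_commute:
  assumes L: "linear_contraction L" and inv: "\<And>x y. (x, y) \<in> A \<Longrightarrow> (L x, L y) \<in> A" and t: "t \<ge> 0"
  shows "T t (L x) = L (T t x)"
proof -
  have "(J h ^^ n) (L x) = L ((J h ^^ n) x)" if "h \<ge> 0" for h n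
    by (induction n) (simp_all add: J_commute[OF L inv that])
  moreover have "(\<lambda>k. L ((J (t / 2 ^ k) ^^ (2 ^ k)) x)) \<longlonglongrightarrow> L (T t x)"
    using L by (intro bounded_linear.tendsto[OF _ euler_convergent[OF t]])
      (simp add: linear_contraction_def bounded_clinear_def)
  ultimately show ?thesis
    using euler_convergent[OF t, of "L x"] t LIMSEQ_unique by auto
qed

text \<open>Membership of \<open>(x, y)\<close> in \<open>A\<close> is the identity \<open>x = J\<^sub>1 (x - y)\<close>, which \<open>T\<close> preserves because it commutes
  with \<open>J\<^sub>1\<close>.\<close>

lemma T_invariant:
  assumes xy: "(x, y) \<in> A" and t: "t \<ge> 0"
  shows "(T t x, T t y) \<in> A"
proof -
  have comm: "T t (J 1 u) = J 1 (T t u)" for u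
    by (intro T_commute J_contraction J_invariant t) auto
  have "J 1 (x - y) = x" using J_eq[OF xy, of 1] by simp
  then have eq: "J 1 (T t x - T t y) = T t x"
    using comm[of "x - y"] by (simp add: linear_contraction_diff[OF T_contraction[OF t]])
  obtain z where "(J 1 (T t x - T t y), z) \<in> A" "J 1 (T t x - T t y) - 1 *\<^sub>R z = T t x - T t y"
    by (rule J_graph[of 1]) auto
  then show ?thesis unfolding eq by simp
qed

lemma T_T_commute: "s \<ge> 0 \<Longrightarrow> t \<ge> 0 \<Longrightarrow> T s (T t x) = T t (T s x)"
  by (intro T_commute T_contraction T_invariant)

lemma T_double:
  assumes t: "t \<ge> 0"
  shows "T (2 * t) = T t \<circ> T t"
proof
  fix x
  have "(\<lambda>k. (J (2 * t / 2 ^ Suc k) ^^ (2 ^ Suc k)) x) \<longlonglongrightarrow> T (2 * t) x"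
    using euler_convergent[of "2 * t" x] t by (intro LIMSEQ_Suc) auto
  moreover have "J (2 * t / 2 ^ Suc k) ^^ (2 ^ Suc k) = (J (t / 2 ^ k) ^^ (2 ^ k)) \<circ> (J (t / 2 ^ k) ^^ (2 ^ k))" for k
  proof -
    have "2 * t / 2 ^ Suc k = t / 2 ^ k" "(2::nat) ^ Suc k = 2 ^ k + 2 ^ k" by simp_all
    then show ?thesis by (simp only: funpow_add)
  qed
  ultimately have "(\<lambda>k. (J (t / 2 ^ k) ^^ (2 ^ k)) ((J (t / 2 ^ k) ^^ (2 ^ k)) x)) \<longlonglongrightarrow> T (2 * t) x"
    by (simp only: comp_apply)
  moreover have "(\<lambda>k. (J (t / 2 ^ k) ^^ (2 ^ k)) ((J (t / 2 ^ k) ^^ (2 ^ k)) x)) \<longlonglongrightarrow> T t (T t x)"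
    using t by (intro contraction_tendsto_apply[OF _ euler_convergent euler_convergent])
      (simp_all add: J_power_contraction)
  ultimately show "T (2 * t) x = (T t \<circ> T t) x"
    using LIMSEQ_unique by auto
qed

lemma T_tangent:
  assumes xy: "(x, y) \<in> A" and yz: "(y', z') \<in> A" and t: "t \<ge> 0"
  shows "norm (T t x - x - t *\<^sub>R y) \<le> t * (2 * norm (y - y') + t * norm z')"
proof (rule LIMSEQ_le_const2)
  show "(\<lambda>k. norm ((J (t / 2 ^ k) ^^ (2 ^ k)) x - x - t *\<^sub>R y)) \<longlonglongrightarrow> norm (T t x - x - t *\<^sub>R y)"
    by (intro tendsto_intros euler_convergent t)
  show "\<exists>N. \<forall>k\<ge>N. norm ((J (t / 2 ^ k) ^^ (2 ^ k)) x - x - t *\<^sub>R y)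
      \<le> t * (2 * norm (y - y') + t * norm z')"
  proof (intro exI allI impI)
    fix k
    show "norm ((J (t / 2 ^ k) ^^ (2 ^ k)) x - x - t *\<^sub>R y) \<le> t * (2 * norm (y - y') + t * norm z')"
      using euler_tangent[OF xy yz, of "t / 2 ^ k" "2 ^ k"] t by simp
  qed
qed

lemma graph_subset_generator: "A \<subseteq> semigroup_generator T"
proof clarify
  fix x y assume xy: "(x, y) \<in> A"
  have "((\<lambda>t. (T t x - x) /\<^sub>R t) \<longlongrightarrow> y) (at_right 0)"
  proof (rule tendstoI)
    fix e :: real assume e: "0 < e"
    then obtain y' where y': "y' \<in> Domain A" "norm (y - y') < e / 4"
      using closure_approx[OF dense, of "e / 4" y] by auto
    then obtain z' where z': "(y', z') \<in> A" by auto
    have "((\<lambda>t. t * norm z') \<longlongrightarrow> 0) (at_right 0)"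
      by (intro tendsto_eq_intros) auto
    then have "\<forall>\<^sub>F t in at_right 0. t * norm z' < e / 2"
      using e by (intro order_tendstoD) auto
    moreover have "\<forall>\<^sub>F t in at_right 0. (0::real) < t"
      by (simp add: eventually_at_filter)
    ultimately show "\<forall>\<^sub>F t in at_right 0. dist ((T t x - x) /\<^sub>R t) y < e"
    proof eventually_elim
      case (elim t)
      have "(T t x - x) /\<^sub>R t - y = (T t x - x - t *\<^sub>R y) /\<^sub>R t"
        using elim by (simp add: scaleR_diff_right)
      then have "dist ((T t x - x) /\<^sub>R t) y = inverse \<bar>t\<bar> * norm (T t x - x - t *\<^sub>R y)"
        by (simp only: dist_norm norm_scaleR abs_inverse)
      also have "\<dots> \<le> 2 * norm (y - y') + t * norm z'"
        using T_tangent[OF xy z', of t] elim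
        by (simp add: pos_divide_le_eq mult.commute flip: divide_inverse_commute)
      also have "\<dots> < e" using elim y'(2) by simp
      finally show ?case .
    qed
  qed
  then show "(x, y) \<in> semigroup_generator T" by (simp add: semigroup_generator_def)
qed

lemma T_tendsto: "((\<lambda>t. T t x) \<longlongrightarrow> x) (at_right 0)"
proof (rule contraction_tendsto_id_dense[OF _ dense])
  show "\<forall>\<^sub>F h in at_right 0. linear_contraction (T h)"
    by (auto simp: eventually_at_filter T_contraction intro!: always_eventually)
  fix x assume "x \<in> Domain A"
  then obtain y where "(x, y) \<in> semigroup_generator T" using graph_subset_generator by auto
  then have "((\<lambda>t. x + t *\<^sub>R ((T t x - x) /\<^sub>R t)) \<longlongrightarrow> x + 0 *\<^sub>R y) (at_right 0)"
    unfolding semigroup_generator_def by (intro tendsto_intros) auto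
  moreover have "\<forall>\<^sub>F t in at_right 0. x + t *\<^sub>R ((T t x - x) /\<^sub>R t) = T t x"
    by (auto simp: eventually_at_filter)
  ultimately show "((\<lambda>t. T t x) \<longlongrightarrow> x) (at_right 0)"
    by (auto intro: Lim_transform_eventually)
qed

text \<open>For fixed \<open>s\<close> and \<open>t\<close>, the families \<open>r \<mapsto> T(r s) T(r t)\<close> and \<open>r \<mapsto> T(r (s + t))\<close> have the same tangent
  \<open>(s + t) A\<close> at \<open>r = 0\<close>, hence agree at \<open>r = 1\<close>.\<close>

lemma T_add:
  assumes "s \<ge> 0" "t \<ge> 0"
  shows "T (s + t) = T s \<circ> T t"
proof (cases "s = 0 \<or> t = 0")
  case False
  then have s: "s > 0" and t: "t > 0" using assms by auto
  have "T (1 * s) \<circ> T (1 * t) = T (1 * (s + t))"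
  proof (rule contraction_families_eq[where P = "\<lambda>r. T (r * s) \<circ> T (r * t)"
        and Q = "\<lambda>r. T (r * (s + t))", OF _ _ _ _ _ dense])
    fix h :: real assume h: "h > 0"
    have nn: "0 \<le> h * s" "0 \<le> h * t" "0 \<le> h * (s + t)" using h s t by simp_all
    show "linear_contraction (T (h * s) \<circ> T (h * t))" "linear_contraction (T (h * (s + t)))"
      by (intro linear_contraction_comp T_contraction nn)+
    show "(T (h * s) \<circ> T (h * t)) (T (h * (s + t)) x) = T (h * (s + t)) ((T (h * s) \<circ> T (h * t)) x)" for x
      unfolding comp_apply T_T_commute[OF nn(2,3)] T_T_commute[OF nn(1,3)] ..
    have "T (2 * h * a) = T (h * a) \<circ> T (h * a)" if "a > 0" for a
      using T_double[of "h * a"] h that by (simp add: mult.assoc)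
    note double = this[OF s] this[OF t] this[OF add_pos_pos[OF s t]]
    show "T (2 * h * (s + t)) = T (h * (s + t)) \<circ> T (h * (s + t))" by (rule double)
    show "T (2 * h * s) \<circ> T (2 * h * t) = (T (h * s) \<circ> T (h * t)) \<circ> (T (h * s) \<circ> T (h * t))"
      unfolding double fun_eq_iff comp_apply T_T_commute[OF nn(2,1)] by simp
  next
    fix x assume "x \<in> Domain A"
    then obtain y where y: "(x, y) \<in> semigroup_generator T" using graph_subset_generator by auto
    have "(x, s *\<^sub>R y + t *\<^sub>R y) \<in> semigroup_generator (\<lambda>r. T (r * s) \<circ> T (r * t))"
    proof (intro semigroup_generator_comp semigroup_generator_rescale y s t)
      have "filterlim (\<lambda>h. h * s) (at_right 0) (at_right 0)"
        unfolding filterlim_at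
        using s by (auto simp: eventually_at_filter intro!: always_eventually tendsto_eq_intros)
      then show "((\<lambda>h. T (h * s) (t *\<^sub>R y)) \<longlongrightarrow> t *\<^sub>R y) (at_right 0)"
        by (rule filterlim_compose[OF T_tendsto])
    qed (use s in \<open>simp add: T_contraction\<close>)
    moreover have "(x, (s + t) *\<^sub>R y) \<in> semigroup_generator (\<lambda>r. T (r * (s + t)))"
      using s t by (intro semigroup_generator_rescale y) simp
    ultimately show "\<exists>y. (x, y) \<in> semigroup_generator (\<lambda>r. T (r * s) \<circ> T (r * t))
        \<and> (x, y) \<in> semigroup_generator (\<lambda>r. T (r * (s + t)))"
      by (auto simp: scaleR_add_left)
  qed auto
  then show ?thesis by simp
qed auto

lemma T_C0_semigroup: "C0_semigroup T"
  using T_contraction by (auto simp: C0_semigroup_def T_tendsto T_add linear_contraction_def)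

end

section \<open>Generation of contraction semigroups\<close>

text \<open>The range of \<open>I - h A\<close> is closed by the estimates for dissipative relations, and a vector \<open>v\<close> orthogonal
  to it satisfies \<open>A\<^sup>* v = v / h\<close>, which dissipativity of \<open>A\<^sup>*\<close> permits only for \<open>v = 0\<close>.\<close>

lemma m_dissipativeI:
  assumes "dissipative A" "closed A" "densely_defined A" "dissipative (op_adjoint A)"
  shows "m_dissipative A"
proof
  show "dissipative A" by fact
  show "closure (Domain A) = UNIV" using assms by (simp add: densely_defined_def)
  fix h :: real and u :: 'a
  assume h: "0 < h"
  have lin: "linear_relation A" using assms by (simp add: dissipative_def)
  let ?R = "(\<lambda>p. fst p - h *\<^sub>R snd p) ` A"
  have "linear (\<lambda>p :: 'a \<times> 'a. fst p - h *\<^sub>R snd p)"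
    by (rule linearI) (simp_all add: algebra_simps)
  then have "subspace ?R"
    using lin by (intro linear_subspace_image) (simp_all add: linear_relation_def csubspace_def)
  moreover have "closed ?R"
    unfolding closed_sequential_limits
  proof clarify
    fix s l assume s: "\<forall>n. s n \<in> ?R" and l: "s \<longlonglongrightarrow> l"
    then have "\<forall>n. \<exists>p. p \<in> A \<and> s n = fst p - h *\<^sub>R snd p" by blast
    then obtain p where p: "\<And>n. p n \<in> A" "\<And>n. s n = fst (p n) - h *\<^sub>R snd (p n)" by metis
    have est: "norm (fst (p m) - fst (p n)) \<le> norm (s m - s n)"
      "h * norm (snd (p m) - snd (p n)) \<le> norm (s m - s n)" for m n
    proof -
      have "(fst (p m) - fst (p n), snd (p m) - snd (p n)) \<in> A"
        using linear_relation_diff[OF lin] p(1) by simp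
      moreover have "s m - s n = (fst (p m) - fst (p n)) - h *\<^sub>R (snd (p m) - snd (p n))"
        by (simp add: p(2) algebra_simps)
      ultimately show "norm (fst (p m) - fst (p n)) \<le> norm (s m - s n)"
        "h * norm (snd (p m) - snd (p n)) \<le> norm (s m - s n)"
        using dissipative_norms[OF assms(1), of _ _ h] h by simp_all
    qed
    have s_Cauchy: "Cauchy s" using l by (rule LIMSEQ_imp_Cauchy)
    have "Cauchy (\<lambda>n. fst (p n))"
    proof (rule CauchyI)
      fix e :: real assume "0 < e"
      then show "\<exists>M. \<forall>m\<ge>M. \<forall>n\<ge>M. norm (fst (p m) - fst (p n)) < e"
        using CauchyD[OF s_Cauchy] est(1) by (meson le_less_trans)
    qed
    moreover have "Cauchy (\<lambda>n. snd (p n))"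
    proof (rule CauchyI)
      fix e :: real assume "0 < e"
      then obtain M where M: "\<And>m n. m \<ge> M \<Longrightarrow> n \<ge> M \<Longrightarrow> norm (s m - s n) < h * e"
        using CauchyD[OF s_Cauchy, of "h * e"] h by auto
      have "norm (snd (p m) - snd (p n)) < e" if "m \<ge> M" "n \<ge> M" for m n
      proof -
        have "h * norm (snd (p m) - snd (p n)) < h * e" using est(2) M[OF that] by (rule le_less_trans)
        then show ?thesis using h by simp
      qed
      then show "\<exists>M. \<forall>m\<ge>M. \<forall>n\<ge>M. norm (snd (p m) - snd (p n)) < e" by blast
    qed
    ultimately obtain x y where x: "(\<lambda>n. fst (p n)) \<longlonglongrightarrow> x" and y: "(\<lambda>n. snd (p n)) \<longlonglongrightarrow> y"
      using Cauchy_convergent convergent_def by metis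
    have "p \<longlonglongrightarrow> (x, y)" using tendsto_Pair[OF x y] by simp
    then have "(x, y) \<in> A" using assms(2) p(1) closed_sequentially by blast
    moreover have "s \<longlonglongrightarrow> x - h *\<^sub>R y"
      using x y unfolding p(2) by (intro tendsto_intros)
    then have "l = x - h *\<^sub>R y" using l LIMSEQ_unique by blast
    ultimately show "l \<in> ?R" by force
  qed
  ultimately obtain p where p: "p \<in> ?R" and orth: "\<And>r. r \<in> ?R \<Longrightarrow> inner (u - p) r = 0"
    using Hilbert_projection[of ?R u] by blast
  have "inner y (u - p) = inner x ((1 / h) *\<^sub>R (u - p))" if "(x, y) \<in> A" for x y
  proof -
    have "inner (u - p) (x - h *\<^sub>R y) = 0" using that by (intro orth) force
    then show ?thesis using h by (simp add: inner_diff_right inner_commute[of "u - p"])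
  qed
  then have "(u - p, (1 / h) *\<^sub>R (u - p)) \<in> op_adjoint A"
    by (simp add: op_adjoint_inner[OF lin])
  then have "inner (u - p) ((1 / h) *\<^sub>R (u - p)) \<le> 0"
    using assms(4) by (simp only: dissipative_inner)
  then have "inner (u - p) (u - p) \<le> 0"
    using h by (simp only: inner_scaleR_right) (simp add: divide_le_0_iff)
  then have "u = p" using inner_self_le_0 by fastforce
  then show "\<exists>x y. (x, y) \<in> A \<and> x - h *\<^sub>R y = u" using p by force
qed

lemma contraction_generator_inner:
  assumes "\<And>t. t \<ge> 0 \<Longrightarrow> norm (T t x) \<le> norm x" and "(x, y) \<in> semigroup_generator T"
  shows "inner x y \<le> 0"
proof (rule tendsto_upperbound)
  show "((\<lambda>t. inner x ((T t x - x) /\<^sub>R t)) \<longlongrightarrow> inner x y) (at_right 0)"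
    using assms(2) unfolding semigroup_generator_def by (intro tendsto_intros) simp
  have "inner x ((T t x - x) /\<^sub>R t) \<le> 0" if "t > 0" for t
  proof -
    have "inner x (T t x) \<le> norm x * norm (T t x)" by (rule norm_cauchy_schwarz)
    also have "\<dots> \<le> norm x * norm x" using assms(1)[of t] that by (intro mult_left_mono) auto
    finally have "inner x (T t x - x) \<le> 0"
      by (simp add: inner_diff_right power2_norm_eq_inner[symmetric] power2_eq_square)
    then show ?thesis using that
      by (simp only: inner_scaleR_right) (simp add: mult_nonneg_nonpos)
  qed
  then show "\<forall>\<^sub>F t in at_right 0. inner x ((T t x - x) /\<^sub>R t) \<le> 0"
    by (simp add: eventually_at_filter)
qed simp

text \<open>The generator is dissipative and extends \<open>A\<close>. As \<open>I - A\<close> is already onto, there is no room for a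
  proper extension.\<close>

lemma (in m_dissipative) T_generator: "semigroup_generator T = A"
proof
  show "semigroup_generator T \<subseteq> A"
  proof clarify
    fix x y assume xy: "(x, y) \<in> semigroup_generator T"
    obtain a b where ab: "(a, b) \<in> A" "a - 1 *\<^sub>R b = x - y"
      using range[of 1 "x - y"] by auto
    have "((\<lambda>t. (T t x - x) /\<^sub>R t - (T t a - a) /\<^sub>R t) \<longlongrightarrow> y - b) (at_right 0)"
      using xy graph_subset_generator ab(1)
      by (intro tendsto_diff) (auto simp: semigroup_generator_def)
    moreover have "\<forall>\<^sub>F t in at_right 0. (T t x - x) /\<^sub>R t - (T t a - a) /\<^sub>R t = (T t (x - a) - (x - a)) /\<^sub>R t"
      by (auto simp: eventually_at_filter linear_contraction_diff[OF T_contraction] algebra_simps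
          intro!: always_eventually)
    ultimately have "((\<lambda>t. (T t (x - a) - (x - a)) /\<^sub>R t) \<longlongrightarrow> y - b) (at_right 0)"
      by (rule Lim_transform_eventually)
    then have "(x - a, y - b) \<in> semigroup_generator T"
      by (simp add: semigroup_generator_def)
    then have "inner (x - a) (y - b) \<le> 0"
      by (intro contraction_generator_inner[of T]) (auto intro: linear_contraction_norm T_contraction)
    moreover have "y - b = x - a" using ab(2) by (simp add: algebra_simps)
    ultimately have "inner (x - a) (x - a) \<le> 0" by simp
    then have "x = a" using inner_self_le_0 by fastforce
    then have "y = b" using ab(2) by simp
    then show "(x, y) \<in> A" using \<open>x = a\<close> ab(1) by simp
  qed
qed (rule graph_subset_generator)

text \<open>For \<open>u\<close> in the domain of \<open>A\<close> and \<open>z = A\<^sup>* y\<close>, formally \<open>\<langle>T(t) u - u, y\<rangle> = \<integral>\<^sub>0\<^sup>t \<langle>T(s) u, z\<rangle> ds\<close>, and this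
  extends to \<open>u = y\<close> by density. Then the left side has nonpositive real part by contractivity, while the
  right side is \<open>t \<langle>y, z\<rangle> + o(t)\<close>. Riemann sums take the place of the integral.\<close>

lemma adjoint_dissipative_if_subset_generator:
  assumes C0: "C0_semigroup T" and contr: "\<And>t x. t \<ge> 0 \<Longrightarrow> norm (T t x) \<le> norm x"
    and gen: "A \<subseteq> semigroup_generator T"
    and inv: "\<And>t x y. t \<ge> 0 \<Longrightarrow> (x, y) \<in> A \<Longrightarrow> (T t x, T t y) \<in> A"
    and dense: "closure (Domain A) = UNIV" and lin: "linear_relation A"
  shows "dissipative (op_adjoint A)"
  unfolding dissipative_inner
proof (intro conjI allI impI linear_relation_op_adjoint)
  fix y z assume "(y, z) \<in> op_adjoint A"
  then have adj: "\<And>u v. (u, v) \<in> A \<Longrightarrow> inner v y = inner u z"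
    by (simp add: op_adjoint_inner[OF lin])
  have T: "linear_contraction (T t)" if "t \<ge> 0" for t
    using that C0 contr by (simp add: C0_semigroup_def linear_contraction_def)
  have T_add: "T (s + t) x = T s (T t x)" if "s \<ge> 0" "t \<ge> 0" for s t x
    using that C0 by (simp add: C0_semigroup_def)
  have T_0: "T 0 = id" using C0 by (simp add: C0_semigroup_def)
  \<comment> \<open>The integral formula for \<open>u\<close> with the integrand frozen at \<open>s = 0\<close>; \<open>M\<close> bounds the resulting error.\<close>
  have key: "\<bar>inner (T t u - u) y - t * inner u z\<bar> \<le> t * M * norm z"
    if uv: "(u, v) \<in> A" and t: "t > 0" and M: "\<And>s. 0 \<le> s \<Longrightarrow> s \<le> t \<Longrightarrow> norm (T s u - u) \<le> M" for u v t M
  proof -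
    \<comment> \<open>The remainder of the difference quotient, which vanishes with the step size \<open>h\<close>.\<close>
    define r where "r h = (T h u - u) /\<^sub>R h - v" for h
    have step: "\<bar>inner (T (n * h) u - u) y - n * h * inner u z\<bar> \<le> n * h * (M * norm z + norm (r h) * norm y)"
      if h: "h > 0" and "n * h \<le> t" for n :: nat and h :: real
      using that(2)
    proof (induction n)
      case 0
      then show ?case by (simp add: T_0)
    next
      case (Suc n)
      have nh: "n * h \<ge> 0" "n * h \<le> t" using h Suc.prems by (simp_all add: algebra_simps)
      note S = T[OF nh(1)]
      have "T h u - u = h *\<^sub>R (v + r h)" using h by (simp add: r_def)
      moreover have "T (Suc n * h) u = T (n * h) (T h u)"
        using T_add[OF nh(1), of h u] h by (simp add: algebra_simps)
      ultimately have "T (Suc n * h) u = T (n * h) (u + h *\<^sub>R (v + r h))"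
        by (simp add: algebra_simps)
      then have "T (Suc n * h) u = T (n * h) u + h *\<^sub>R (T (n * h) v + T (n * h) (r h))"
        by (simp only: linear_contraction_add[OF S] linear_contraction_scaleR[OF S])
      moreover have "inner (T (n * h) v) y = inner (T (n * h) u - u) z + inner u z"
        using adj[OF inv[OF nh(1) uv]] by (simp add: inner_diff_left)
      ultimately have "inner (T (Suc n * h) u - u) y - Suc n * h * inner u z
          = (inner (T (n * h) u - u) y - n * h * inner u z)
            + h * (inner (T (n * h) u - u) z + inner (T (n * h) (r h)) y)"
        by (simp add: inner_diff_left inner_add_left algebra_simps)
      also have "\<bar>\<dots>\<bar> \<le> n * h * (M * norm z + norm (r h) * norm y) + h * (M * norm z + norm (r h) * norm y)"
      proof (rule order_trans[OF abs_triangle_ineq add_mono])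
        show "\<bar>inner (T (n * h) u - u) y - n * h * inner u z\<bar> \<le> n * h * (M * norm z + norm (r h) * norm y)"
          by (rule Suc.IH[OF nh(2)])
        have "\<bar>inner (T (n * h) u - u) z\<bar> \<le> M * norm z"
          using Cauchy_Schwarz_ineq2[of "T (n * h) u - u" z] mult_right_mono[OF M[OF nh], of "norm z"] by simp
        moreover have "\<bar>inner (T (n * h) (r h)) y\<bar> \<le> norm (r h) * norm y"
          using Cauchy_Schwarz_ineq2[of "T (n * h) (r h)" y]
            mult_right_mono[OF contr[OF nh(1)], of "norm y" "r h"] by simp
        ultimately have "\<bar>inner (T (n * h) u - u) z + inner (T (n * h) (r h)) y\<bar> \<le> M * norm z + norm (r h) * norm y"
          by linarith
        then show "\<bar>h * (inner (T (n * h) u - u) z + inner (T (n * h) (r h)) y)\<bar> \<le> h * (M * norm z + norm (r h) * norm y)"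
          using h by (simp add: abs_mult)
      qed
      also have "\<dots> = Suc n * h * (M * norm z + norm (r h) * norm y)" by (simp add: algebra_simps)
      finally show ?case .
    qed
    have "(r \<longlongrightarrow> v - v) (at_right 0)"
      unfolding r_def using gen uv by (intro tendsto_intros) (auto simp: semigroup_generator_def)
    moreover have "filterlim (\<lambda>n. t / real (Suc n)) (at_right 0) sequentially"
    proof -
      have "(\<lambda>n. t * inverse (real (Suc n))) \<longlonglongrightarrow> t * 0"
        by (intro tendsto_intros LIMSEQ_inverse_real_of_nat)
      then show ?thesis using t by (auto simp: filterlim_at divide_inverse)
    qed
    ultimately have "(\<lambda>n. r (t / real (Suc n))) \<longlonglongrightarrow> 0"
      using filterlim_compose[of r "nhds 0" "at_right 0"] by simp
    then have "(\<lambda>n. t * (M * norm z + norm (r (t / real (Suc n))) * norm y)) \<longlonglongrightarrow> t * (M * norm z + norm (0 :: 'a) * norm y)"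
      by (intro tendsto_intros)
    moreover have "\<bar>inner (T t u - u) y - t * inner u z\<bar> \<le> t * (M * norm z + norm (r (t / real (Suc n))) * norm y)" for n
      using step[of "t / real (Suc n)" "Suc n"] t by simp
    ultimately have "\<bar>inner (T t u - u) y - t * inner u z\<bar> \<le> t * (M * norm z + norm (0 :: 'a) * norm y)"
      by (intro LIMSEQ_le_const) auto
    then show ?thesis by (simp add: mult.assoc)
  qed
  \<comment> \<open>On a time interval \<open>[0, t]\<close> on which the orbit of \<open>y\<close> moves by at most \<open>e\<close>, replace \<open>u\<close> by a sequence
    from the domain of \<open>A\<close> tending to \<open>y\<close>.\<close>
  have bound: "inner y z \<le> e * norm z" if e: "e > 0" for e
  proof -
    have "\<forall>\<^sub>F t in at_right 0. dist (T t y) y < e"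
      using C0 e by (intro tendstoD) (auto simp: C0_semigroup_def)
    then obtain d where d: "d > 0" "\<And>s. 0 < s \<Longrightarrow> s < d \<Longrightarrow> norm (T s y - y) < e"
      by (auto simp: eventually_at_right_field dist_norm)
    define t where "t = d / 2"
    have t: "t > 0" "\<And>s. 0 \<le> s \<Longrightarrow> s \<le> t \<Longrightarrow> norm (T s y - y) \<le> e"
    proof -
      show "t > 0" using d by (simp add: t_def)
      fix s assume "0 \<le> s" "s \<le> t"
      then show "norm (T s y - y) \<le> e"
        using d(2)[of s] d(1) e T_0 by (cases "s = 0") (auto simp: t_def intro: less_imp_le)
    qed
    obtain u where u: "\<And>n. u n \<in> Domain A" "u \<longlonglongrightarrow> y"
      using dense closure_sequential[of y "Domain A"] by auto
    have est: "\<bar>inner (T t (u n) - u n) y - t * inner (u n) z\<bar> \<le> t * (e + 2 * norm (u n - y)) * norm z" for n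
    proof -
      obtain v where v: "(u n, v) \<in> A" using u(1)[of n] by auto
      show ?thesis
      proof (rule key[OF v t(1)])
        fix s assume s: "0 \<le> s" "s \<le> t"
        have "T s (u n) - u n = T s (u n - y) + (T s y - y) + (y - u n)"
          by (simp add: linear_contraction_diff[OF T[OF s(1)]])
        then have "norm (T s (u n) - u n) \<le> norm (T s (u n - y)) + norm (T s y - y) + norm (y - u n)"
          by (simp only: norm_triangle_3)
        then show "norm (T s (u n) - u n) \<le> e + 2 * norm (u n - y)"
          using t(2)[OF s] contr[OF s(1), of "u n - y"] by (simp add: norm_minus_commute)
      qed
    qed
    have "bounded_linear (T t)" using T[of t] t(1) by (simp add: linear_contraction_def bounded_clinear_def)
    then have Tu: "(\<lambda>n. T t (u n)) \<longlonglongrightarrow> T t y" using u(2) by (rule bounded_linear.tendsto)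
    have "\<bar>inner (T t y - y) y - t * inner y z\<bar> \<le> t * (e + 2 * norm (y - y)) * norm z"
    proof (rule LIMSEQ_le)
      show "(\<lambda>n. \<bar>inner (T t (u n) - u n) y - t * inner (u n) z\<bar>) \<longlonglongrightarrow> \<bar>inner (T t y - y) y - t * inner y z\<bar>"
        by (intro tendsto_intros Tu u)
      show "(\<lambda>n. t * (e + 2 * norm (u n - y)) * norm z) \<longlonglongrightarrow> t * (e + 2 * norm (y - y)) * norm z"
        by (intro tendsto_intros u)
    qed (use est in blast)
    moreover have "inner (T t y - y) y \<le> 0"
    proof -
      have "inner (T t y) y \<le> norm (T t y) * norm y" by (rule norm_cauchy_schwarz)
      also have "\<dots> \<le> norm y * norm y" using contr[of t y] t(1) by (intro mult_right_mono) auto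
      finally show ?thesis
        by (simp add: inner_diff_left power2_norm_eq_inner[symmetric] power2_eq_square)
    qed
    ultimately have "t * inner y z \<le> t * (e * norm z)" by simp
    then show ?thesis using t(1) by simp
  qed
  show "inner y z \<le> 0"
  proof (rule field_le_epsilon)
    fix e :: real assume "0 < e"
    then have "inner y z \<le> e / (norm z + 1) * norm z"
      by (intro bound) (simp add: add_nonneg_pos)
    also have "\<dots> \<le> e" using \<open>0 < e\<close> by (simp add: pos_divide_le_eq add_nonneg_pos)
    finally show "inner y z \<le> 0 + e" by simp
  qed
qed

lemma semigroup_generator_invariant:
  assumes C0: "C0_semigroup T" and "(x, y) \<in> semigroup_generator T" "s \<ge> 0"
  shows "(T s x, T s y) \<in> semigroup_generator T"
proof -
  have "bounded_linear (T s)" using C0 assms(3) by (simp add: C0_semigroup_def bounded_clinear_def)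
  then interpret bounded_linear "T s" .
  have "((\<lambda>t. T s ((T t x - x) /\<^sub>R t)) \<longlongrightarrow> T s y) (at_right 0)"
    using assms(2) unfolding semigroup_generator_def by (intro tendsto) auto
  moreover have "T s (T t x) = T t (T s x)" if "t > 0" for t
  proof -
    have "T s \<circ> T t = T t \<circ> T s"
      using C0 assms(3) that unfolding C0_semigroup_def by (metis add.commute less_imp_le)
    then show ?thesis by (metis comp_apply)
  qed
  then have "\<forall>\<^sub>F t in at_right 0. T s ((T t x - x) /\<^sub>R t) = (T t (T s x) - T s x) /\<^sub>R t"
    by (simp add: eventually_at_filter scaleR diff)
  ultimately show ?thesis
    unfolding semigroup_generator_def by (auto intro: Lim_transform_eventually)
qed

theorem Lumer_Phillips:
  assumes lin: "linear_relation A" and "closed A" and dense: "densely_defined A"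
  shows "generates_contraction_semigroup A \<longleftrightarrow> dissipative A \<and> dissipative (op_adjoint A)"
proof
  assume "generates_contraction_semigroup A"
  then obtain T where C0: "C0_semigroup T" and contr: "\<And>t x. t \<ge> 0 \<Longrightarrow> norm (T t x) \<le> norm x"
    and gen: "semigroup_generator T = A"
    by (auto simp: generates_contraction_semigroup_def)
  have "dissipative A"
    unfolding dissipative_inner using lin contraction_generator_inner[of T] contr gen by blast
  moreover have "dissipative (op_adjoint A)"
    using adjoint_dissipative_if_subset_generator[OF C0 contr, of A] gen lin dense
      semigroup_generator_invariant[OF C0] by (simp add: densely_defined_def)
  ultimately show "dissipative A \<and> dissipative (op_adjoint A)" ..
next
  assume "dissipative A \<and> dissipative (op_adjoint A)"
  then interpret m_dissipative A
    using assms by (intro m_dissipativeI) simp_all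
  show "generates_contraction_semigroup A"
    unfolding generates_contraction_semigroup_def
    using T_C0_semigroup T_generator linear_contraction_norm[OF T_contraction] by blast
qed

section \<open>Generation of unitary groups\<close>

lemma tendsto_at_0_iff:
  fixes f :: "real \<Rightarrow> 'a::topological_space"
  shows "(f \<longlongrightarrow> l) (at 0) \<longleftrightarrow> (f \<longlongrightarrow> l) (at_right 0) \<and> ((\<lambda>t. f (- t)) \<longlongrightarrow> l) (at_right 0)"
  using filterlim_at_left_to_right[of f "nhds l" 0] by (auto simp: filterlim_at_split[of f _ 0])

text \<open>A two-sided derivative consists of a right derivative and the reflected left derivative.\<close>

lemma group_generator_iff:
  "(x, y) \<in> group_generator U \<longleftrightarrow>
    (x, y) \<in> semigroup_generator U \<and> (x, - y) \<in> semigroup_generator (\<lambda>t. U (- t))"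
proof -
  have "((\<lambda>t. (U (- t) x - x) /\<^sub>R - t) \<longlongrightarrow> y) (at_right 0) \<longleftrightarrow>
      ((\<lambda>t. (U (- t) x - x) /\<^sub>R t) \<longlongrightarrow> - y) (at_right 0)"
    using tendsto_minus_cancel_left[of "\<lambda>t. (U (- t) x - x) /\<^sub>R t" y "at_right 0"] by simp
  then show ?thesis
    by (simp add: group_generator_def semigroup_generator_def tendsto_at_0_iff)
qed

lemma norm_preserving_cinner:
  fixes L :: "'a::complex_inner \<Rightarrow> 'a"
  assumes L: "bounded_clinear L" and norm: "\<And>x. norm (L x) = norm x"
  shows "cinner (L x) (L y) = cinner x y"
proof -
  interpret bounded_linear L using L by (simp add: bounded_clinear_def)
  have inner: "inner (L x) (L y) = inner x y" for x y
    using norm[of "x + y"] by (simp add: dot_norm norm flip: add)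
  show ?thesis
  proof (rule complex_eqI)
    show "Re (cinner (L x) (L y)) = Re (cinner x y)"
      using inner[of x y] by (simp add: inner_eq_Re_cinner)
    show "Im (cinner (L x) (L y)) = Im (cinner x y)"
      using inner[of x "\<i> *\<^sub>C y"] L by (simp add: Im_cinner bounded_clinear_def)
  qed
qed

text \<open>A unitary group is a pair of contraction semigroups, in forward and in backward time, generated by \<open>A\<close>
  and \<open>-A\<close>. Conversely, the semigroups generated by \<open>A\<close> and \<open>-A\<close> commute and their product has zero
  tangent, so that they are inverse to each other; being contractions, they are then isometric.\<close>

theorem unitary_group_generation:
  assumes lin: "linear_relation A" and closed: "closed A" and dense: "densely_defined A"
  shows "generates_unitary_group A \<longleftrightarrow> skew_symmetric A \<and> skew_symmetric (op_adjoint A)"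
proof
  assume "generates_unitary_group A"
  then obtain U where C0: "C0_group U" and unitary: "\<And>t. unitary (U t)" and gen: "group_generator U = A"
    by (auto simp: generates_unitary_group_def)
  have norm: "norm (U t x) = norm x" for t x
    using unitary[of t] by (simp add: norm_eq_sqrt_inner inner_eq_Re_cinner unitary_def)
  have C0': "C0_semigroup U" "C0_semigroup (\<lambda>t. U (- t))"
  proof -
    have lin: "bounded_clinear (U t)" and zero: "U 0 = id" and add: "U (s + t) = U s \<circ> U t"
      and lim: "((\<lambda>t. U t x) \<longlongrightarrow> x) (at 0)" for s t x
      using C0 unfolding C0_group_def by blast+
    show "C0_semigroup U"
      using lin zero add lim unfolding C0_semigroup_def tendsto_at_0_iff by blast
    have "U (- (s + t)) = U (- s) \<circ> U (- t)" for s t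
      using add[of "- s" "- t"] by simp
    then show "C0_semigroup (\<lambda>t. U (- t))"
      using lin zero lim unfolding C0_semigroup_def tendsto_at_0_iff by simp
  qed
  have sub: "A \<subseteq> semigroup_generator U" "op_uminus A \<subseteq> semigroup_generator (\<lambda>t. U (- t))"
    unfolding gen[symmetric] by (auto simp: op_uminus_def group_generator_iff)
  have inv: "(U t x, U t y) \<in> A" if xy: "(x, y) \<in> A" for t x y
  proof -
    have lin: "bounded_linear (U t)" using C0 by (simp add: C0_group_def bounded_clinear_def)
    have "U t \<circ> U s = U s \<circ> U t" for s
      using C0 unfolding C0_group_def by (metis add.commute)
    then have comm: "U t (U s x) = U s (U t x)" for s by (metis comp_apply)
    have "((\<lambda>s. U t ((U s x - x) /\<^sub>R s)) \<longlongrightarrow> U t y) (at 0)"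
      using xy unfolding gen[symmetric] group_generator_def
      by (intro bounded_linear.tendsto[OF lin]) auto
    then show ?thesis
      unfolding gen[symmetric] group_generator_def
      by (simp add: linear_simps[OF lin] comm)
  qed
  have "dissipative (op_adjoint A)"
    using adjoint_dissipative_if_subset_generator[OF C0'(1) _ sub(1)] inv lin dense
    by (simp add: norm densely_defined_def)
  moreover have "dissipative (op_adjoint (op_uminus A))"
  proof (rule adjoint_dissipative_if_subset_generator[OF C0'(2) _ sub(2)])
    fix t x y assume "(x, y) \<in> op_uminus A"
    then have "(U (- t) x, U (- t) (- y)) \<in> A" by (simp add: op_uminus_iff inv)
    moreover have "bounded_linear (U (- t))" using C0 by (simp add: C0_group_def bounded_clinear_def)
    ultimately show "(U (- t) x, U (- t) y) \<in> op_uminus A"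
      by (simp add: op_uminus_iff linear_simps)
  qed (use lin dense in \<open>simp_all add: norm Domain_op_uminus densely_defined_def linear_relation_op_uminus\<close>)
  moreover have "inner x y = 0" if "(x, y) \<in> A" for x y
  proof -
    have "inner x y \<le> 0"
      by (rule contraction_generator_inner[of U]) (use sub(1) that norm in auto)
    moreover have "inner x (- y) \<le> 0"
      by (rule contraction_generator_inner[of "\<lambda>t. U (- t)"])
        (use sub(2) that norm in \<open>auto simp: op_uminus_def\<close>)
    ultimately show ?thesis by simp
  qed
  ultimately show "skew_symmetric A \<and> skew_symmetric (op_adjoint A)"
    unfolding skew_symmetric_iff_dissipative[of "op_adjoint A"] op_adjoint_uminus
      skew_symmetric_inner[of A]
    using lin by blast
next
  assume "skew_symmetric A \<and> skew_symmetric (op_adjoint A)"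
  then have diss: "dissipative A" "dissipative (op_adjoint A)"
    "dissipative (op_uminus A)" "dissipative (op_adjoint (op_uminus A))"
    by (simp_all add: skew_symmetric_iff_dissipative op_adjoint_uminus)
  interpret P: m_dissipative A
    using diss closed dense by (intro m_dissipativeI)
  interpret M: m_dissipative "op_uminus A"
    using diss closed dense
    by (intro m_dissipativeI) (simp_all add: closed_op_uminus densely_defined_def Domain_op_uminus)
  have M_inv: "(M.T t x, M.T t y) \<in> A" if "(x, y) \<in> A" "t \<ge> 0" for t x y
  proof -
    have "(M.T t x, M.T t (- y)) \<in> op_uminus A"
      using that by (intro M.T_invariant) (auto simp: op_uminus_def)
    moreover have "M.T t (- y) = - M.T t y"
      using linear_contraction_scaleR[OF M.T_contraction[OF that(2)], of "- 1" y] by simp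
    ultimately show ?thesis by (simp add: op_uminus_iff)
  qed
  have comm: "P.T s (M.T t x) = M.T t (P.T s x)" if "s \<ge> 0" "t \<ge> 0" for s t x
    using that by (intro P.T_commute M.T_contraction M_inv)
  have inverse: "P.T t \<circ> M.T t = id" if t: "t \<ge> 0" for t
  proof (cases "t = 0")
    case False
    show ?thesis
    proof (rule contraction_families_eq[where P = "\<lambda>t. P.T t \<circ> M.T t" and Q = "\<lambda>_. id",
          OF _ _ _ _ _ P.dense])
      fix h :: real assume h: "h > 0"
      show "linear_contraction (P.T h \<circ> M.T h)"
        using h by (intro linear_contraction_comp P.T_contraction M.T_contraction) auto
      have nn: "h \<ge> 0" using h by simp
      show "P.T (2 * h) \<circ> M.T (2 * h) = (P.T h \<circ> M.T h) \<circ> (P.T h \<circ> M.T h)"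
        unfolding P.T_double[OF nn] M.T_double[OF nn] fun_eq_iff comp_apply comm[OF nn nn] by simp
    next
      fix x assume "x \<in> Domain A"
      then obtain y where y: "(x, y) \<in> A" by auto
      then have "(x, y + - y) \<in> semigroup_generator (\<lambda>t. P.T t \<circ> M.T t)"
        using P.T_contraction P.T_tendsto
        by (intro semigroup_generator_comp) (simp_all add: P.T_generator M.T_generator op_uminus_iff)
      moreover have "(x, 0) \<in> semigroup_generator (\<lambda>_. id)" by (simp add: semigroup_generator_def)
      ultimately show "\<exists>y. (x, y) \<in> semigroup_generator (\<lambda>t. P.T t \<circ> M.T t)
          \<and> (x, y) \<in> semigroup_generator (\<lambda>_. id)" by auto
    qed (use t False in \<open>auto simp: linear_contraction_id\<close>)
  qed simp
  have PM: "P.T t (M.T t x) = x" and MP: "M.T t (P.T t x) = x" if "t \<ge> 0" for t x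
    using fun_cong[OF inverse[OF that], of x] comm[OF that that] by auto
  define U where "U t = (if t \<ge> 0 then P.T t else M.T (- t))" for t
  \<comment> \<open>Cancelling the common part of forward and backward motion; the mixed signs in the group law reduce
    to this.\<close>
  have U: "P.T a (M.T b x) = U (a - b) x" if "a \<ge> 0" "b \<ge> 0" for a b x
  proof (cases "a \<ge> b")
    case True
    then show ?thesis using P.T_add[of "a - b" b] that by (simp add: U_def PM)
  next
    case False
    then show ?thesis using M.T_add[of a "b - a"] that by (simp add: U_def PM)
  qed
  have U_add: "U (s + t) = U s \<circ> U t" for s t
  proof
    fix x
    consider "s \<ge> 0" "t \<ge> 0" | "s < 0" "t < 0" | "s \<ge> 0" "t < 0" | "s < 0" "t \<ge> 0" by linarith
    then show "U (s + t) x = (U s \<circ> U t) x"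
    proof cases
      case 1 then show ?thesis by (simp add: U_def P.T_add)
    next
      case 2 then show ?thesis using M.T_add[of "- s" "- t"] by (simp add: U_def)
    next
      case 3 then show ?thesis using U[of s "- t" x] by (simp add: U_def[of s] U_def[of t])
    next
      case 4 then show ?thesis using U[of t "- s" x] comm[of t "- s" x]
        by (simp add: U_def[of s] U_def[of t] add.commute)
    qed
  qed
  have U_contr: "linear_contraction (U t)" for t
    by (simp add: U_def P.T_contraction M.T_contraction)
  have U_inv: "U (- t) (U t x) = x" for t x
  proof -
    have "U (- t + t) x = (U (- t) \<circ> U t) x" by (simp only: U_add)
    then show ?thesis by (simp add: U_def)
  qed
  have U_right: "\<forall>\<^sub>F t in at_right 0. U t = P.T t" "\<forall>\<^sub>F t in at_right 0. U (- t) = M.T t"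
    by (auto simp: eventually_at_filter U_def)
  have "unitary (U t)" for t
  proof -
    have "norm (U t x) = norm x" for x
      using linear_contraction_norm[OF U_contr, of t x] linear_contraction_norm[OF U_contr, of "- t" "U t x"]
      by (simp add: U_inv)
    moreover have "surj (U t)"
      using U_inv[of "- t"] by (intro surjI[of _ "U (- t)"]) simp
    ultimately show ?thesis
      using U_contr[of t] norm_preserving_cinner[of "U t"]
      by (simp add: unitary_def linear_contraction_def)
  qed
  moreover have "C0_group U"
  proof -
    have "((\<lambda>t. U t x) \<longlongrightarrow> x) (at 0)" for x
      unfolding tendsto_at_0_iff
    proof
      show "((\<lambda>t. U t x) \<longlongrightarrow> x) (at_right 0)"
        by (rule Lim_transform_eventually[OF P.T_tendsto]) (use U_right(1) in eventually_elim, simp)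
      show "((\<lambda>t. U (- t) x) \<longlongrightarrow> x) (at_right 0)"
        by (rule Lim_transform_eventually[OF M.T_tendsto]) (use U_right(2) in eventually_elim, simp)
    qed
    then show ?thesis
      using U_contr U_add by (simp add: C0_group_def linear_contraction_def) (simp add: U_def)
  qed
  moreover have "group_generator U = A"
  proof -
    have gen_cong: "semigroup_generator S = semigroup_generator S'"
      if "\<forall>\<^sub>F t in at_right 0. S t = S' t" for S S' :: "real \<Rightarrow> 'a \<Rightarrow> 'a"
    proof -
      have "((\<lambda>t. (S t x - x) /\<^sub>R t) \<longlongrightarrow> y) (at_right 0) \<longleftrightarrow> ((\<lambda>t. (S' t x - x) /\<^sub>R t) \<longlongrightarrow> y) (at_right 0)" for x y
        by (rule tendsto_cong) (use that in eventually_elim, simp)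
      then show ?thesis by (simp add: semigroup_generator_def)
    qed
    have "(x, y) \<in> group_generator U \<longleftrightarrow> (x, y) \<in> A" for x y
      by (simp add: group_generator_iff gen_cong[OF U_right(1)] gen_cong[OF U_right(2)]
          P.T_generator M.T_generator op_uminus_iff)
    then show ?thesis by auto
  qed
  ultimately show "generates_unitary_group A"
    unfolding generates_unitary_group_def by blast
qed

section \<open>Restrictions of the adjoint by boundary relations\<close>

text \<open>A map on the domain of \<open>A\<^sub>0\<^sup>*\<close> is a total function with arbitrary values elsewhere, so that linearity and
  Green's identity below are available only for points of the graph of \<open>A\<^sub>0\<^sup>*\<close>.\<close>

locale boundary_triplet_operator =
  fixes A0 :: "('x::chilbert_space \<times> 'x) set" and B1 B2 :: "'x \<Rightarrow> 'b::chilbert_space"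
  assumes dense0: "densely_defined A0" and skew0: "skew_symmetric A0"
    and triplet: "boundary_triplet A0 B1 B2"
begin

abbreviation "A0' \<equiv> op_adjoint A0"

definition boundary_restriction :: "('b \<times> 'b) set \<Rightarrow> ('x \<times> 'x) set" where
  "boundary_restriction N = {(x, y). (x, y) \<in> A0' \<and> (B1 x, B2 x) \<in> N}"

lemma lin0: "linear_relation A0"
  using skew0 by (simp add: skew_symmetric_def)

lemma boundary_add:
  assumes "(x, y) \<in> A0'" "(x', y') \<in> A0'"
  shows "B1 (x + x') = B1 x + B1 x'" "B2 (x + x') = B2 x + B2 x'"
proof -
  have "x \<in> Domain A0'" "x' \<in> Domain A0'" using assms by auto
  then show "B1 (x + x') = B1 x + B1 x'" "B2 (x + x') = B2 x + B2 x'"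
    using triplet unfolding boundary_triplet_def graph_bounded_clinear_def by simp_all
qed

lemma boundary_scaleC:
  assumes "(x, y) \<in> A0'"
  shows "B1 (c *\<^sub>C x) = c *\<^sub>C B1 x" "B2 (c *\<^sub>C x) = c *\<^sub>C B2 x"
proof -
  have "x \<in> Domain A0'" using assms by auto
  then show "B1 (c *\<^sub>C x) = c *\<^sub>C B1 x" "B2 (c *\<^sub>C x) = c *\<^sub>C B2 x"
    using triplet unfolding boundary_triplet_def graph_bounded_clinear_def by simp_all
qed

lemma boundary_diff:
  assumes "(x, y) \<in> A0'" "(x', y') \<in> A0'"
  shows "B1 (x - x') = B1 x - B1 x'" "B2 (x - x') = B2 x - B2 x'"
proof -
  have "(- x', - y') \<in> A0'"
    using linear_relation_scaleC[OF linear_relation_op_adjoint assms(2), of "- 1"] by (simp add: scaleC_minus_1)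
  from boundary_add[OF assms(1) this] boundary_scaleC[OF assms(2), of "- 1"]
  show "B1 (x - x') = B1 x - B1 x'" "B2 (x - x') = B2 x - B2 x'"
    by (simp_all add: scaleC_minus_1)
qed

lemma boundary_0: "B1 0 = 0" "B2 0 = 0"
  using boundary_diff[OF linear_relation_0[OF linear_relation_op_adjoint] linear_relation_0[OF linear_relation_op_adjoint]]
  by simp_all

lemma boundary_onto:
  obtains x y where "(x, y) \<in> A0'" "B1 x = f" "B2 x = e"
proof -
  have "(f, e) \<in> (\<lambda>x. (B1 x, B2 x)) ` Domain A0'"
    using triplet by (auto simp: boundary_triplet_def)
  then show ?thesis using that by auto
qed

lemma Green:
  assumes "(x, y) \<in> A0'" "(x', y') \<in> A0'"
  shows "cinner y x' + cinner x y' = cinner (B1 x) (B2 x') + cinner (B2 x) (B1 x')"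
  using triplet assms unfolding boundary_triplet_def by blast

lemma inner_boundary:
  assumes "(x, y) \<in> A0'"
  shows "inner x y = inner (B1 x) (B2 x)"
  using arg_cong[OF Green[OF assms assms], of Re]
  by (simp add: inner_commute flip: inner_eq_Re_cinner)

text \<open>For \<open>(x, y)\<close> in the extension and \<open>u\<close> in the domain of \<open>A\<^sub>0\<close>, the form at \<open>(x, y) + r (u, -A\<^sub>0 u)\<close> has no
  term quadratic in \<open>r\<close>. It can be nonpositive for all real \<open>r\<close> only if the linear term vanishes, which is
  the defining equation of \<open>A\<^sub>0\<^sup>*\<close>.\<close>

lemma dissipative_extension_subset_adjoint:
  assumes R: "dissipative R" and sub: "op_uminus A0 \<subseteq> R"
  shows "R \<subseteq> A0'"
proof clarify
  fix x y assume xy: "(x, y) \<in> R"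
  have linR: "linear_relation R" using R by (simp add: dissipative_def)
  have "inner v x = inner u y" if uv: "(u, v) \<in> A0" for u v
  proof -
    define s where "s = inner u y - inner v x"
    have uv': "(u, - v) \<in> R" using sub uv by (auto simp: op_uminus_def)
    have le: "inner x y + r * s \<le> 0" for r
    proof -
      have "(x + r *\<^sub>R u, y + r *\<^sub>R - v) \<in> R"
        by (intro linear_relation_add[OF linR] linear_relation_scaleR[OF linR] xy uv')
      then have "inner (x + r *\<^sub>R u) (y + r *\<^sub>R - v) \<le> 0"
        using R by (simp only: dissipative_inner)
      moreover have "inner u v = 0" using skew0 uv by (simp add: skew_symmetric_inner)
      ultimately show ?thesis
        by (simp add: s_def inner_add_left inner_add_right inner_commute algebra_simps)
    qed
    have "s = 0"
    proof (rule ccontr)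
      assume "s \<noteq> 0"
      \<comment> \<open>At this value of \<open>r\<close> the left side of the inequality equals \<open>1\<close>.\<close>
      then show False using le[of "(1 - inner x y) / s"] by simp
    qed
    then show ?thesis by (simp add: s_def)
  qed
  then show "(x, y) \<in> A0'" by (simp add: op_adjoint_inner[OF lin0])
qed

lemma uminus_subset_adjoint: "op_uminus A0 \<subseteq> A0'"
proof (rule dissipative_extension_subset_adjoint)
  show "dissipative (op_uminus A0)"
    using skew0 by (simp add: skew_symmetric_iff_dissipative)
qed simp

text \<open>By Green's identity \<open>(B\<^sub>1 x, B\<^sub>2 x)\<close> pairs to zero with all boundary values, in particular with
  \<open>(B\<^sub>2 x, B\<^sub>1 x)\<close>, which is attained because the boundary map is onto.\<close>

lemma boundary_uminus:
  assumes "(x, y) \<in> op_uminus A0"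
  shows "B1 x = 0" "B2 x = 0"
proof -
  obtain x' y' where x': "(x', y') \<in> A0'" "B1 x' = B2 x" "B2 x' = B1 x"
    using boundary_onto .
  have "inner y x' + inner x y' = 0"
    using assms x'(1) by (auto simp: op_uminus_def op_adjoint_inner[OF lin0])
  moreover have "(x, y) \<in> A0'" using assms uminus_subset_adjoint by auto
  from arg_cong[OF Green[OF this x'(1)], of Re]
  have "inner y x' + inner x y' = inner (B1 x) (B1 x) + inner (B2 x) (B2 x)"
    by (simp add: x' flip: inner_eq_Re_cinner)
  ultimately have "inner (B1 x) (B1 x) + inner (B2 x) (B2 x) = 0" by simp
  then show "B1 x = 0" "B2 x = 0"
    by (simp_all add: add_nonneg_eq_0_iff)
qed

lemma uminus_subset_restriction:
  assumes "linear_relation N"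
  shows "op_uminus A0 \<subseteq> boundary_restriction N"
  using uminus_subset_adjoint boundary_uminus linear_relation_0[OF assms]
  by (auto simp: boundary_restriction_def)

lemma dense_restriction:
  assumes "linear_relation N"
  shows "densely_defined (boundary_restriction N)"
proof -
  have "Domain A0 \<subseteq> Domain (boundary_restriction N)"
    using Domain_mono[OF uminus_subset_restriction[OF assms]] by (simp add: Domain_op_uminus)
  then show ?thesis
    using dense0 closure_mono unfolding densely_defined_def by blast
qed

lemma linear_restriction:
  assumes N: "linear_relation N"
  shows "linear_relation (boundary_restriction N)"
proof (rule linear_relationI)
  show "(0, 0) \<in> boundary_restriction N"
    using linear_relation_0[OF N] linear_relation_0[OF linear_relation_op_adjoint]
    by (simp add: boundary_restriction_def boundary_0)
next
  fix x y x' y' assume "(x, y) \<in> boundary_restriction N" "(x', y') \<in> boundary_restriction N"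
  then show "(x + x', y + y') \<in> boundary_restriction N"
    using linear_relation_add[OF N] linear_relation_add[OF linear_relation_op_adjoint]
    by (auto simp: boundary_restriction_def boundary_add)
next
  fix c x y assume "(x, y) \<in> boundary_restriction N"
  then show "(c *\<^sub>C x, c *\<^sub>C y) \<in> boundary_restriction N"
    using linear_relation_scaleC[OF N] linear_relation_scaleC[OF linear_relation_op_adjoint]
    by (auto simp: boundary_restriction_def boundary_scaleC)
qed

lemma dissipative_restriction:
  assumes "linear_relation N"
  shows "dissipative (boundary_restriction N) \<longleftrightarrow> dissipative N"
proof
  assume *: "dissipative (boundary_restriction N)"
  have "inner f e \<le> 0" if "(f, e) \<in> N" for f e
  proof -
    obtain x y where xy: "(x, y) \<in> A0'" "B1 x = f" "B2 x = e" by (rule boundary_onto)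
    then have "(x, y) \<in> boundary_restriction N" using that by (simp add: boundary_restriction_def)
    then have "inner x y \<le> 0" using * by (simp add: dissipative_inner)
    then show ?thesis using inner_boundary[OF xy(1)] xy by simp
  qed
  then show "dissipative N" using assms by (simp add: dissipative_inner)
next
  assume "dissipative N"
  then show "dissipative (boundary_restriction N)"
    using linear_restriction[OF assms]
    by (auto simp: dissipative_inner boundary_restriction_def inner_boundary)
qed

text \<open>Dissipative extensions of the restriction lie in \<open>A\<^sub>0\<^sup>*\<close>, so that they are controlled by their
  boundary values; these form a dissipative relation extending \<open>N\<close>.\<close>

lemma maximal_dissipative_restriction:
  assumes N: "linear_relation N"
  shows "maximal_dissipative (boundary_restriction N) \<longleftrightarrow> maximal_dissipative N"
proof
  assume max: "maximal_dissipative (boundary_restriction N)"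
  show "maximal_dissipative N"
    unfolding maximal_dissipative_def
  proof (intro conjI allI impI)
    show "dissipative N"
      using max dissipative_restriction[OF N] by (simp add: maximal_dissipative_def)
    fix M assume M: "dissipative M \<and> N \<subseteq> M"
    then have "dissipative (boundary_restriction M)"
      using dissipative_restriction[of M] by (auto simp: dissipative_def)
    moreover have "boundary_restriction N \<subseteq> boundary_restriction M"
      using M by (auto simp: boundary_restriction_def)
    ultimately have eq: "boundary_restriction M = boundary_restriction N"
      using max by (simp add: maximal_dissipative_def)
    have "(f, e) \<in> N" if "(f, e) \<in> M" for f e
    proof -
      obtain x y where xy: "(x, y) \<in> A0'" "B1 x = f" "B2 x = e" by (rule boundary_onto)
      then have "(x, y) \<in> boundary_restriction M" using that by (simp add: boundary_restriction_def)
      then show ?thesis unfolding eq using xy by (simp add: boundary_restriction_def)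
    qed
    then show "M = N" using M by auto
  qed
next
  assume max: "maximal_dissipative N"
  show "maximal_dissipative (boundary_restriction N)"
    unfolding maximal_dissipative_def
  proof (intro conjI allI impI)
    show "dissipative (boundary_restriction N)"
      using max dissipative_restriction[OF N] by (simp add: maximal_dissipative_def)
    fix R assume R: "dissipative R \<and> boundary_restriction N \<subseteq> R"
    have linR: "linear_relation R" using R by (simp add: dissipative_def)
    have sub: "R \<subseteq> A0'"
      using R uminus_subset_restriction[OF N] by (intro dissipative_extension_subset_adjoint) auto
    define M where "M = {(B1 x, B2 x) | x y. (x, y) \<in> R}"
    have MI: "(f, e) \<in> M" if "(x, y) \<in> R" "f = B1 x" "e = B2 x" for x y f e
      using that by (auto simp: M_def)
    have "linear_relation M"
    proof (rule linear_relationI)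
      show "(0, 0) \<in> M"
        by (rule MI[OF linear_relation_0[OF linR]]) (simp_all add: boundary_0)
    next
      fix f e f' e' assume "(f, e) \<in> M" "(f', e') \<in> M"
      then obtain x y x' y' where *: "(x, y) \<in> R" "f = B1 x" "e = B2 x"
        "(x', y') \<in> R" "f' = B1 x'" "e' = B2 x'" by (auto simp: M_def)
      show "(f + f', e + e') \<in> M"
        using boundary_add[OF subsetD[OF sub *(1)] subsetD[OF sub *(4)]] *
        by (intro MI[OF linear_relation_add[OF linR *(1) *(4)]]) simp_all
    next
      fix c f e assume "(f, e) \<in> M"
      then obtain x y where *: "(x, y) \<in> R" "f = B1 x" "e = B2 x" by (auto simp: M_def)
      show "(c *\<^sub>C f, c *\<^sub>C e) \<in> M"
        using boundary_scaleC[OF subsetD[OF sub *(1)]] *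
        by (intro MI[OF linear_relation_scaleC[OF linR *(1)]]) simp_all
    qed
    moreover have "inner f e \<le> 0" if fe: "(f, e) \<in> M" for f e
    proof -
      obtain x y where *: "(x, y) \<in> R" "f = B1 x" "e = B2 x" using fe by (auto simp: M_def)
      then have "inner x y \<le> 0" using R by (simp add: dissipative_inner)
      then show ?thesis using inner_boundary[OF subsetD[OF sub *(1)]] * by simp
    qed
    ultimately have "dissipative M" by (simp add: dissipative_inner)
    moreover have "N \<subseteq> M"
    proof clarify
      fix f e assume "(f, e) \<in> N"
      obtain x y where xy: "(x, y) \<in> A0'" "B1 x = f" "B2 x = e" by (rule boundary_onto)
      then have "(x, y) \<in> R" using \<open>(f, e) \<in> N\<close> R by (auto simp: boundary_restriction_def)
      then show "(f, e) \<in> M" using xy by (auto simp: M_def)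
    qed
    ultimately have "M = N" using max by (simp add: maximal_dissipative_def)
    then have "R \<subseteq> boundary_restriction N"
      using sub MI by (auto simp: boundary_restriction_def)
    then show "R = boundary_restriction N" using R by auto
  qed
qed

lemma closed_adjoint: "closed A0'"
proof -
  have "A0' = (\<Inter>(u, v)\<in>A0. {p. inner v (fst p) = inner u (snd p)})"
    by (fastforce simp: op_adjoint_inner[OF lin0])
  moreover have "closed (\<Inter>(u, v)\<in>A0. {p :: 'x \<times> 'x. inner v (fst p) = inner u (snd p)})"
    by (intro closed_INT ballI) (auto intro!: closed_Collect_eq continuous_intros)
  ultimately show ?thesis by simp
qed

lemma boundary_tendsto:
  assumes p: "\<And>n. p n \<in> A0'" "p \<longlonglongrightarrow> (x, y)" "(x, y) \<in> A0'"
  shows "(\<lambda>n. B1 (fst (p n))) \<longlonglongrightarrow> B1 x" "(\<lambda>n. B2 (fst (p n))) \<longlonglongrightarrow> B2 x"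
proof -
  obtain C1 where C1: "\<forall>(x, y)\<in>A0'. norm (B1 x) \<le> C1 * norm (x, y)"
    using triplet unfolding boundary_triplet_def graph_bounded_clinear_def by auto
  obtain C2 where C2: "\<forall>(x, y)\<in>A0'. norm (B2 x) \<le> C2 * norm (x, y)"
    using triplet unfolding boundary_triplet_def graph_bounded_clinear_def by auto
  have C: "norm (B1 x) \<le> C1 * norm (x, y)" "norm (B2 x) \<le> C2 * norm (x, y)" if "(x, y) \<in> A0'" for x y
    using C1 C2 that by auto
  have lim: "(\<lambda>n. C * norm (p n - (x, y))) \<longlonglongrightarrow> 0" for C
    using tendsto_mult[OF tendsto_const tendsto_norm_zero[OF LIM_zero[OF p(2)]], of C] by simp
  have diff: "(fst (p n) - x, snd (p n) - y) \<in> A0'" for n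
    using linear_relation_diff[OF linear_relation_op_adjoint, of "fst (p n)" "snd (p n)"] p by simp
  have eq: "p n - (x, y) = (fst (p n) - x, snd (p n) - y)" for n
    by (simp add: prod_eq_iff)
  have pn: "(fst (p n), snd (p n)) \<in> A0'" for n using p(1) by simp
  show "(\<lambda>n. B1 (fst (p n))) \<longlonglongrightarrow> B1 x"
    using C(1)[OF diff] boundary_diff(1)[OF pn p(3)]
    by (intro LIM_zero_cancel[OF Lim_null_comparison[OF _ lim[of C1]]]) (simp add: eq)
  show "(\<lambda>n. B2 (fst (p n))) \<longlonglongrightarrow> B2 x"
    using C(2)[OF diff] boundary_diff(2)[OF pn p(3)]
    by (intro LIM_zero_cancel[OF Lim_null_comparison[OF _ lim[of C2]]]) (simp add: eq)
qed

lemma closed_restriction: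
  assumes "closed N"
  shows "closed (boundary_restriction N)"
  unfolding closed_sequential_limits
proof clarify
  fix p x y assume p: "\<forall>n. p n \<in> boundary_restriction N" and lim: "p \<longlonglongrightarrow> (x, y)"
  have pn: "p n \<in> A0'" "(B1 (fst (p n)), B2 (fst (p n))) \<in> N" for n
    using p[rule_format, of n] by (auto simp: boundary_restriction_def)
  have xy: "(x, y) \<in> A0'" using closed_sequentially[OF closed_adjoint pn(1) lim] .
  have "(B1 x, B2 x) \<in> N"
    using closed_sequentially[OF assms pn(2) tendsto_Pair[OF boundary_tendsto[OF pn(1) lim xy]]] .
  with xy show "(x, y) \<in> boundary_restriction N" by (simp add: boundary_restriction_def)
qed

text \<open>The adjoint is contained in \<open>-A\<^sub>0\<^sup>*\<close> because the restriction contains \<open>-A\<^sub>0\<close>. On \<open>-A\<^sub>0\<^sup>*\<close>, Green's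
  identity turns the defining equation into orthogonality of boundary values, with the two components
  exchanged.\<close>

lemma adjoint_restriction:
  assumes N: "linear_relation N"
  shows "(x, y) \<in> op_adjoint (boundary_restriction N) \<longleftrightarrow>
    (x, - y) \<in> A0' \<and> (\<forall>p\<in>N. cinner p (B2 x, B1 x) = 0)"
proof -
  have "(x, - y) \<in> A0'" if "(x, y) \<in> op_adjoint (boundary_restriction N)"
  proof -
    have "op_adjoint (boundary_restriction N) \<subseteq> op_adjoint (op_uminus A0)"
    proof (rule subrelI)
      fix x y assume "(x, y) \<in> op_adjoint (boundary_restriction N)"
      then show "(x, y) \<in> op_adjoint (op_uminus A0)"
        using uminus_subset_restriction[OF N] unfolding op_adjoint_iff by blast
    qed
    then show ?thesis using that by (auto simp: op_adjoint_uminus op_uminus_iff)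
  qed
  moreover have "(x, y) \<in> op_adjoint (boundary_restriction N) \<longleftrightarrow> (\<forall>p\<in>N. cinner p (B2 x, B1 x) = 0)"
    if xy: "(x, - y) \<in> A0'"
  proof -
    have green: "cinner v x = cinner u y \<longleftrightarrow> cinner (B1 u, B2 u) (B2 x, B1 x) = 0"
      if "(u, v) \<in> A0'" for u v
    proof -
      have "cinner v x - cinner u y = cinner (B1 u, B2 u) (B2 x, B1 x)"
        using Green[OF that xy] by (simp add: cinner_prod_def cinner_simps)
      then show ?thesis by (metis eq_iff_diff_eq_0)
    qed
    show ?thesis
    proof
      assume *: "(x, y) \<in> op_adjoint (boundary_restriction N)"
      show "\<forall>p\<in>N. cinner p (B2 x, B1 x) = 0"
      proof clarify
        fix f e assume fe: "(f, e) \<in> N"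
        obtain u v where uv: "(u, v) \<in> A0'" "B1 u = f" "B2 u = e" by (rule boundary_onto)
        then have "cinner v x = cinner u y"
          using * fe by (simp add: op_adjoint_iff boundary_restriction_def)
        then show "cinner (f, e) (B2 x, B1 x) = 0" using green[OF uv(1)] uv by simp
      qed
    next
      assume *: "\<forall>p\<in>N. cinner p (B2 x, B1 x) = 0"
      then show "(x, y) \<in> op_adjoint (boundary_restriction N)"
        using green by (auto simp: op_adjoint_iff boundary_restriction_def)
    qed
  qed
  ultimately show ?thesis by blast
qed

end

section \<open>Boundary conditions given by an operator\<close>

locale boundary_operator =
  fixes W :: "'b::chilbert_space \<times> 'b \<Rightarrow> 'k::chilbert_space"
  assumes W: "bounded_clinear W"
begin

definition "W1 f = W (f, 0)"
definition "W2 e = W (0, e)"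

abbreviation "V k \<equiv> (cadjoint W2 k, cadjoint W1 k)"

lemma bounded_W: "bounded_linear W"
  using W by (simp add: bounded_clinear_def)

lemma W_split: "W (f, e) = W1 f + W2 e"
  using linear_simps(1)[OF bounded_W, of "(f, 0)" "(0, e)"] by (simp add: W1_def W2_def)

lemma W_scaleC: "W (c *\<^sub>C f, c *\<^sub>C e) = c *\<^sub>C W (f, e)"
proof -
  have "W (c *\<^sub>C (f, e)) = c *\<^sub>C W (f, e)" using W by (simp only: bounded_clinear_def)
  then show ?thesis by (simp add: scaleC_prod_def)
qed

lemma bounded_W12: "bounded_clinear W1" "bounded_clinear W2"
proof -
  have "bounded_linear (\<lambda>f. W (f, 0))" "bounded_linear (\<lambda>e. W (0, e))"
    by (intro bounded_linear_compose[OF bounded_W] bounded_linear_Pair bounded_linear_ident bounded_linear_zero)+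
  then show "bounded_clinear W1" "bounded_clinear W2"
    using W_scaleC[of _ _ 0] W_scaleC[of _ 0]
    by (simp_all add: bounded_clinear_def W1_def[abs_def] W2_def[abs_def] scaleC_zero)
qed

lemma linear_kernel: "linear_relation {p. W p = 0}"
proof (rule linear_relationI)
  show "(c *\<^sub>C f, c *\<^sub>C e) \<in> {p. W p = 0}" if "(f, e) \<in> {p. W p = 0}" for c f e
    using that by (simp add: W_scaleC scaleC_zero)
  show "(f + f', e + e') \<in> {p. W p = 0}" if "(f, e) \<in> {p. W p = 0}" "(f', e') \<in> {p. W p = 0}" for f e f' e'
    using that linear_simps(1)[OF bounded_W, of "(f, e)" "(f', e')"] by simp
  show "(0, 0) \<in> {p. W p = 0}"
    using linear_simps(3)[OF bounded_W] by (simp add: zero_prod_def)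
qed

lemma closed_kernel: "closed {p. W p = 0}"
  by (intro closed_Collect_eq linear_continuous_on bounded_W continuous_on_const)

lemma cinner_W: "cinner (W (f, e)) k = cinner (f, e) (cadjoint W1 k, cadjoint W2 k)"
  by (simp add: W_split cinner_add_left cinner_cadjoint[OF bounded_W12(1)] cinner_cadjoint[OF bounded_W12(2)]
      cinner_prod_def)

text \<open>The orthogonal complement of \<open>ker W\<close> is the closed range of \<open>W\<^sup>* = (W\<^sub>1\<^sup>*, W\<^sub>2\<^sup>*)\<close>, written with exchanged
  components as in \<open>adjoint_restriction\<close>. If \<open>(a, b)\<close> is the part of \<open>(f, e)\<close> orthogonal to the range
  of \<open>V\<close>, then \<open>(b, a)\<close> lies in \<open>ker W\<close>, so that it is orthogonal to \<open>(e, f)\<close> and vanishes.\<close>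

lemma orthogonal_kernel_iff:
  "(\<forall>p\<in>{p. W p = 0}. cinner p (e, f) = 0) \<longleftrightarrow> (f, e) \<in> closure (range V)"
proof
  assume fe: "(f, e) \<in> closure (range V)"
  show "\<forall>p\<in>{p. W p = 0}. cinner p (e, f) = 0"
  proof clarify
    fix b a assume "W (b, a) = 0"
    then have "range V \<subseteq> {q. cinner b (snd q) + cinner a (fst q) = 0}"
      using cinner_W[of b a] by (auto simp: cinner_simps cinner_prod_def)
    moreover have "closed {q. cinner b (snd q) + cinner a (fst q) = 0}"
      by (intro closed_Collect_eq continuous_intros
          bounded_bilinear.continuous_on[OF bounded_bilinear_cinner])
    ultimately have "closure (range V) \<subseteq> {q. cinner b (snd q) + cinner a (fst q) = 0}"
      by (rule closure_minimal)
    then show "cinner (b, a) (e, f) = 0" using fe by (auto simp: cinner_prod_def)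
  qed
next
  assume orth: "\<forall>p\<in>{p. W p = 0}. cinner p (e, f) = 0"
  have "linear V"
    by (rule linearI)
      (simp_all add: cadjoint_add bounded_W12 scaleR_scaleC cadjoint_scaleC scaleC_prod_def)
  then have "subspace (closure (range V))"
    by (intro subspace_closure linear_subspace_image subspace_UNIV)
  then obtain p where p: "p \<in> closure (range V)"
    and perp: "\<And>s. s \<in> closure (range V) \<Longrightarrow> inner ((f, e) - p) s = 0"
    using Hilbert_projection[of "closure (range V)" "(f, e)"] by auto
  obtain a b where ab: "(f, e) - p = (a, b)" by (cases "(f, e) - p")
  have "inner (W (b, a)) k = 0" for k
  proof -
    have "inner (a, b) (V k) = 0"
      using perp[of "V k"] closure_subset[of "range V"] by (auto simp: ab)
    then have "Re (cinner (b, a) (cadjoint W1 k, cadjoint W2 k)) = 0"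
      by (simp add: cinner_prod_def inner_eq_Re_cinner)
    then show ?thesis by (simp add: inner_eq_Re_cinner cinner_W)
  qed
  from this[of "W (b, a)"] have "W (b, a) = 0" by simp
  then have "cinner (b, a) (e, f) = 0" using orth by blast
  then have "Re (cinner (b, a) (e, f)) = 0" by simp
  then have "inner (a, b) (f, e) = 0"
    by (simp add: cinner_prod_def inner_eq_Re_cinner)
  moreover have "inner (a, b) p = 0" using perp[OF p] by (simp add: ab)
  moreover have "inner (a, b) (a, b) = inner (a, b) (f, e) - inner (a, b) p"
    by (simp only: inner_diff_right[symmetric] ab)
  ultimately have "inner (a, b) (a, b) = 0" by simp
  then have "(a, b) = 0" by (simp only: inner_eq_zero_iff)
  then have "(f, e) = p" using ab by simp
  then show "(f, e) \<in> closure (range V)" using p by simp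
qed

text \<open>For closed \<open>S\<close> the condition passes from the range to its closure by continuity. The sets \<open>{0..}\<close> and
  \<open>{0}\<close> give nonnegativity and vanishing of the form.\<close>

lemma closure_range_inner:
  assumes "closed S"
  shows "(\<forall>(f, e)\<in>closure (range V). inner f e \<in> S) \<longleftrightarrow> (\<forall>k. inner (cadjoint W2 k) (cadjoint W1 k) \<in> S)"
proof
  assume *: "\<forall>k. inner (cadjoint W2 k) (cadjoint W1 k) \<in> S"
  have "closed {q :: 'b \<times> 'b. inner (fst q) (snd q) \<in> S}"
    using continuous_closed_vimage[OF assms, of "\<lambda>q :: 'b \<times> 'b. inner (fst q) (snd q)"]
    by (simp add: vimage_def continuous_intros)
  then have "closure (range V) \<subseteq> {q. inner (fst q) (snd q) \<in> S}"
    using * by (intro closure_minimal) auto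
  then show "\<forall>(f, e)\<in>closure (range V). inner f e \<in> S" by auto
qed (use closure_subset[of "range V"] in auto)

abbreviation "M k \<equiv> W1 (cadjoint W2 k) + W2 (cadjoint W1 k)"

lemma cinner_M:
  "cinner (M k) l = cinner (cadjoint W2 k) (cadjoint W1 l) + cinner (cadjoint W1 k) (cadjoint W2 l)"
  by (simp add: cinner_add_left cinner_cadjoint[OF bounded_W12(1)] cinner_cadjoint[OF bounded_W12(2)])

lemma inner_M: "inner (M k) k = 2 * inner (cadjoint W2 k) (cadjoint W1 k)"
  using cinner_M[of k k] by (simp only: inner_eq_Re_cinner plus_complex.simps)
    (simp add: inner_commute flip: inner_eq_Re_cinner)

lemma nonneg_M: "nonneg_operator M \<longleftrightarrow> (\<forall>k. 0 \<le> inner (cadjoint W2 k) (cadjoint W1 k))"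
proof -
  have "cinner (M k) k \<in> \<real>" for k
    unfolding cinner_M complex_is_Real_iff
    by (subst cinner_commute[of "cadjoint W1 k"]) simp
  then show ?thesis
    unfolding nonneg_operator_def inner_eq_Re_cinner[symmetric] inner_M by simp
qed

lemma zero_M: "(\<forall>k. M k = 0) \<longleftrightarrow> (\<forall>k. inner (cadjoint W2 k) (cadjoint W1 k) = 0)"
proof
  assume "\<forall>k. M k = 0"
  then show "\<forall>k. inner (cadjoint W2 k) (cadjoint W1 k) = 0"
    using inner_M by (metis inner_zero_left mult_eq_0_iff zero_neq_numeral)
next
  assume *: "\<forall>k. inner (cadjoint W2 k) (cadjoint W1 k) = 0"
  have lin: "bounded_linear W1" "bounded_linear W2"
    using bounded_W12 by (simp_all add: bounded_clinear_def)
  have "M k = 0" for k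
  proof (rule symmetric_form_zero[where M = M])
    show "M (x + y) = M x + M y" for x y
      by (simp add: cadjoint_add bounded_W12 linear_simps[OF lin(1)] linear_simps[OF lin(2)])
    show "inner (M x) y = inner x (M y)" for x y
    proof -
      have "inner x (M y) = inner (M y) x" by (rule inner_commute)
      then show ?thesis
        unfolding inner_eq_Re_cinner cinner_M plus_complex.simps
        unfolding inner_eq_Re_cinner[symmetric] by (simp add: inner_commute)
    qed
    show "inner (M x) x = 0" for x using * by (simp only: inner_M)
  qed
  then show "\<forall>k. M k = 0" by blast
qed

end

section \<open>Dissipativity and generation in terms of the boundary conditions\<close>

theorem theorem2p3:
  fixes A0 A :: "('x::chilbert_space \<times> 'x) set"
    and B1 B2 :: "'x \<Rightarrow> 'b::chilbert_space"
    and W_B :: "'b \<times> 'b \<Rightarrow> 'k::chilbert_space"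
    and W1 W2 :: "'b \<Rightarrow> 'k"
  assumes "linear_operator A0" "densely_defined A0" "skew_symmetric A0" "closed A0"
    and "boundary_triplet A0 B1 B2"
    and "bounded_clinear W_B"
    and "W1 = (\<lambda>f. W_B (f, 0))" "W2 = (\<lambda>e. W_B (0, e))"
    and "A = op_restrict (op_adjoint A0) {x \<in> Domain (op_adjoint A0). W1 (B1 x) + W2 (B2 x) = 0}"
  shows "closed A
    \<and> ((dissipative A \<longleftrightarrow> dissipative {p. W_B p = 0})
       \<and> (maximal_dissipative A \<longleftrightarrow> maximal_dissipative {p. W_B p = 0}))
    \<and> (Domain (op_adjoint A) = {x \<in> Domain (op_adjoint A0).
           (B1 x, B2 x) \<in> closure (range (\<lambda>k. (cadjoint W2 k, cadjoint W1 k)))}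
       \<and> op_adjoint A = op_uminus (op_restrict (op_adjoint A0) (Domain (op_adjoint A))))
    \<and> ((dissipative (op_adjoint A) \<longleftrightarrow>
           nonneg_operator (\<lambda>k. W1 (cadjoint W2 k) + W2 (cadjoint W1 k)))
       \<and> (skew_symmetric (op_adjoint A) \<longleftrightarrow>
           (\<forall>k. W1 (cadjoint W2 k) + W2 (cadjoint W1 k) = 0)))
    \<and> (generates_contraction_semigroup A \<longleftrightarrow>
         dissipative A \<and> nonneg_operator (\<lambda>k. W1 (cadjoint W2 k) + W2 (cadjoint W1 k)))
    \<and> (generates_unitary_group A \<longleftrightarrow>
         skew_symmetric A \<and> (\<forall>k. W1 (cadjoint W2 k) + W2 (cadjoint W1 k) = 0))"
proof -
  interpret T: boundary_triplet_operator A0 B1 B2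
    using assms(2,3,5) by unfold_locales
  interpret W: boundary_operator W_B
    using assms(6) by unfold_locales
  have W1: "W1 = W.W1" and W2: "W2 = W.W2"
    using assms(7,8) by (auto simp: W.W1_def W.W2_def)
  let ?N = "{p. W_B p = 0}"
  have A: "A = T.boundary_restriction ?N"
    unfolding assms(9) W1 W2
    by (auto simp: op_restrict_def T.boundary_restriction_def W.W_split)
  note N = W.linear_kernel
  let ?V = "closure (range W.V)"
  have adj: "(x, y) \<in> op_adjoint A \<longleftrightarrow> (x, - y) \<in> op_adjoint A0 \<and> (B1 x, B2 x) \<in> ?V" for x y
    unfolding A T.adjoint_restriction[OF N] W.orthogonal_kernel_iff ..
  have dom: "Domain (op_adjoint A) = {x \<in> Domain (op_adjoint A0). (B1 x, B2 x) \<in> ?V}"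
    by (auto simp: adj Domain_iff) (metis minus_minus)
  \<comment> \<open>The values of the form of \<open>A\<^sup>*\<close> are the negatives of those of the boundary form on \<open>?V\<close>. With \<open>S\<close> the
    set of nonpositive reals, or \<open>{0}\<close>, this expresses that \<open>A\<^sup>*\<close> is dissipative, or skew-symmetric.\<close>
  have form: "(\<forall>x y. (x, y) \<in> op_adjoint A \<longrightarrow> inner x y \<in> S) \<longleftrightarrow> (\<forall>(f, e)\<in>?V. - inner f e \<in> S)" for S
  proof
    assume *: "\<forall>x y. (x, y) \<in> op_adjoint A \<longrightarrow> inner x y \<in> S"
    show "\<forall>(f, e)\<in>?V. - inner f e \<in> S"
    proof clarify
      fix f e assume fe: "(f, e) \<in> ?V"
      obtain x y where xy: "(x, y) \<in> op_adjoint A0" "B1 x = f" "B2 x = e" by (rule T.boundary_onto)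
      then have "(x, - y) \<in> op_adjoint A" using fe by (simp add: adj)
      then have "inner x (- y) \<in> S" using * by blast
      then show "- inner f e \<in> S" using T.inner_boundary[OF xy(1)] xy by simp
    qed
  next
    assume *: "\<forall>(f, e)\<in>?V. - inner f e \<in> S"
    show "\<forall>x y. (x, y) \<in> op_adjoint A \<longrightarrow> inner x y \<in> S"
    proof (intro allI impI)
      fix x y assume "(x, y) \<in> op_adjoint A"
      then have "(x, - y) \<in> op_adjoint A0" and "(B1 x, B2 x) \<in> ?V"
        by (simp_all add: adj)
      from T.inner_boundary[OF this(1)] this(2)
      have "inner x (- y) = inner (B1 x) (B2 x)" "(B1 x, B2 x) \<in> ?V" .
      then have "- inner (B1 x) (B2 x) \<in> S" "inner x y = - inner (B1 x) (B2 x)"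
        using * by auto
      then show "inner x y \<in> S" by simp
    qed
  qed
  have claim1: "closed A"
    unfolding A by (intro T.closed_restriction W.closed_kernel)
  have claim3: "op_adjoint A = op_uminus (op_restrict (op_adjoint A0) (Domain (op_adjoint A)))"
  proof -
    have "(x, y) \<in> op_adjoint A \<longleftrightarrow> (x, y) \<in> op_uminus (op_restrict (op_adjoint A0) (Domain (op_adjoint A)))" for x y
      unfolding op_uminus_iff dom by (auto simp: op_restrict_def adj)
    then show ?thesis by auto
  qed
  have claim4a: "dissipative (op_adjoint A) \<longleftrightarrow> nonneg_operator W.M"
    using form[of "{..0}"] W.closure_range_inner[of "{0..}"]
    by (simp add: dissipative_inner linear_relation_op_adjoint W.nonneg_M)
  have claim4b: "skew_symmetric (op_adjoint A) \<longleftrightarrow> (\<forall>k. W.M k = 0)"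
    using form[of "{0}"] W.closure_range_inner[of "{0}"]
    by (simp add: skew_symmetric_inner linear_relation_op_adjoint W.zero_M)
  have lin: "linear_relation A" and dense: "densely_defined A"
    unfolding A by (rule T.linear_restriction[OF N], rule T.dense_restriction[OF N])
  show ?thesis
    using claim1 claim3 claim4a claim4b dom Lumer_Phillips[OF lin claim1 dense]
      unitary_group_generation[OF lin claim1 dense]
      T.dissipative_restriction[OF N] T.maximal_dissipative_restriction[OF N]
    unfolding W1 W2 A by blast
qed

end
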